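(* Let $w_0\in W$ and let $c=R(\theta_1)R(\theta_2)\cdots R(\theta_n)$ be a factorisation of the Coxeter element $c$ where $\theta_1,\dots,\theta_n$ are positive unit roots. For $1\le j\le n$ put $w_j=w_0R(\theta_1)R(\theta_2)\cdots R(\theta_j)$. Then the following conditions are equivalent. (a) $\langle w_0|w_1|\cdots|w_n\rangle$ is a special $n$-simplex. (b) $w_0^{-1}(v_0)\in\operatorname{cone}(\{-\mu(c\theta_1),-\mu(c\theta_2),\dots,-\mu(c\theta_n)\})$. (c) $w_n^{-1}(v_0)\in\operatorname{cone}(\{-\mu(\theta_1),-\mu(\theta_2),\dots,-\mu(\theta_n)\})$.
   Context: Setup. $W$ is a finite irreducible real reflection group acting effectively (essentially) on $\mathbb{R}^n$. For a nonzero vector $\theta$, $R(\theta)$ is the orthogonal reflection $R(\theta)v=v-2\frac{\theta\cdot v}{\theta\cdot\theta}\theta$. Roots are taken of unit length. A fundamental chamber is fixed; its inward unit normals are the simple roots $\alpha_1,\dots,\alpha_n$ (a basis of $\mathbb{R}^n$), ordered so that, for some $k$, $\{\alpha_1,\dots,\alpha_k\}$ and $\{\alpha_{k+1},\dots,\alpha_n\}$ are both orthonormal sets. A root is positive if it is a nonnegative combination of simple roots. Put $s_i=R(\alpha_i)$, $S=\{s_1,\dots,s_n\}$, $c=s_1s_2\cdots s_n$, and let $T$ be the set of all reflections in $W$. Let $\{\beta_1,\dots,\beta_n\}$ be the basis dual to $\{\alpha_1,\dots,\alpha_n\}$ and $v_0=\beta_1+\dots+\beta_n$. The linear map $\mu:\mathbb{R}^n\to\mathbb{R}^n$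 is $\mu=-2(c-I)^{-1}$ ($c$ has no nonzero fixed vector). $\operatorname{cone}(A)$ is the set of nonnegative linear combinations of the vectors in $A$. Lengths and orders. $l_S$ and $l_T$ are the word lengths on $W$ with respect to $S$ and $T$. $u\le_T w$ means $l_T(u)+l_T(u^{-1}w)=l_T(w)$, and $\lessdot_T$ is its covering relation. $L=\{w\in W\mid w\le_T c\}$ ordered by $\le_T$ is the non-crossing partition lattice. Special $n$-simplices. If $(w_0,\dots,w_n)$ is a tuple in $W$ such that (i) $e\lessdot_T w_0^{-1}w_1\lessdot_T\cdots\lessdot_T w_0^{-1}w_n=c$ is a maximal chain in $L$ and (ii) $l_S(w_i)=l_S(w_0)+i$ for $1\le i\le n$, then the simplex spanned by the (affinely independent) points $w_0(v_0),\dots,w_n(v_0)$ is called a special $n$-simplex and denoted $\langle w_0|w_1|\cdots|w_n\rangle$. *)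

theory Defs
  imports "HOL-Analysis.Analysis"
begin

definition R :: "'a::euclidean_space \<Rightarrow> 'a \<Rightarrow> 'a" where
  "R \<theta> v = v - (2 * (\<theta> \<bullet> v) / (\<theta> \<bullet> \<theta>)) *\<^sub>R \<theta>"

definition reflections :: "('a::euclidean_space \<Rightarrow> 'a) set \<Rightarrow> ('a \<Rightarrow> 'a) set" where
  "reflections W = {t \<in> W. \<exists>\<theta>. \<theta> \<noteq> 0 \<and> t = R \<theta>}"

definition roots :: "('a::euclidean_space \<Rightarrow> 'a) set \<Rightarrow> 'a set" where
  "roots W = {\<theta>. norm \<theta> = 1 \<and> R \<theta> \<in> W}"

text \<open>The list product \<open>f\<^sub>1 f\<^sub>2 \<dots> f\<^sub>m\<close> acts on vectors from the left, so \<open>f\<^sub>m\<close> is applied first.\<close>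

definition compose_list :: "('a \<Rightarrow> 'a) list \<Rightarrow> 'a \<Rightarrow> 'a" where
  "compose_list fs = foldr (\<circ>) fs id"

text \<open>Reflections are involutions, so the finite products of the reflections in \<open>W\<close> are closed
  under inverses: the equation below says that \<open>W\<close> is the group generated by its reflections.\<close>

definition finite_reflection_group :: "('a::euclidean_space \<Rightarrow> 'a) set \<Rightarrow> bool" where
  "finite_reflection_group W \<longleftrightarrow>
     finite W \<and> W = {compose_list ts | ts. set ts \<subseteq> reflections W}"

definition irreducible_action :: "('a::euclidean_space \<Rightarrow> 'a) set \<Rightarrow> bool" where
  "irreducible_action W \<longleftrightarrow>
     (\<forall>U. subspace U \<and> (\<forall>w\<in>W. w ` U \<subseteq> U) \<longrightarrow> U = {0} \<or> U = UNIV)"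

definition essential_action :: "('a::euclidean_space \<Rightarrow> 'a) set \<Rightarrow> bool" where
  "essential_action W \<longleftrightarrow> (\<forall>v. (\<forall>w\<in>W. w v = v) \<longrightarrow> v = 0)"

definition chambers :: "('a::euclidean_space \<Rightarrow> 'a) set \<Rightarrow> 'a set set" where
  "chambers W = components (- (\<Union>\<theta>\<in>roots W. {v. \<theta> \<bullet> v = 0}))"

text \<open>The walls of a chamber are the hyperplanes that cut out a facet of its closure.\<close>

definition inward_unit_normals :: "'a::euclidean_space set \<Rightarrow> 'a set" where
  "inward_unit_normals C =
     {a. norm a = 1 \<and> (\<forall>x\<in>C. a \<bullet> x > 0) \<and>
         (closure C \<inter> {x. a \<bullet> x = 0}) facet_of (closure C)}"

definition orthonormal :: "'a::euclidean_space set \<Rightarrow> bool" where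
  "orthonormal A \<longleftrightarrow> pairwise orthogonal A \<and> (\<forall>a\<in>A. norm a = 1)"

definition nonneg_cone :: "'a::real_vector set \<Rightarrow> 'a set" where
  "nonneg_cone A =
     {\<Sum>a\<in>F. f a *\<^sub>R a | F f. finite F \<and> F \<subseteq> A \<and> (\<forall>a\<in>F. f a \<ge> 0)}"

definition positive_roots ::
    "('a::euclidean_space \<Rightarrow> 'a) set \<Rightarrow> 'a set \<Rightarrow> 'a set" where
  "positive_roots W \<Delta> = roots W \<inter> nonneg_cone \<Delta>"

text \<open>Both sets of generators used below consist of involutions, so words in the generators
  alone suffice. The value is unspecified on maps that are not products of elements of \<open>A\<close>.\<close>

definition word_length :: "('a \<Rightarrow> 'a) set \<Rightarrow> ('a \<Rightarrow> 'a) \<Rightarrow> nat" where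
  "word_length A w = (LEAST m. \<exists>fs. set fs \<subseteq> A \<and> length fs = m \<and> compose_list fs = w)"

text \<open>On elements of \<open>W\<close>, which are bijections, \<^const>\<open>inv\<close> is the group inverse.\<close>

definition le_T ::
    "('a::euclidean_space \<Rightarrow> 'a) set \<Rightarrow> ('a \<Rightarrow> 'a) \<Rightarrow> ('a \<Rightarrow> 'a) \<Rightarrow> bool" where
  "le_T W u w \<longleftrightarrow> u \<in> W \<and> w \<in> W \<and>
     word_length (reflections W) u + word_length (reflections W) (inv u \<circ> w)
       = word_length (reflections W) w"

definition covered_T ::
    "('a::euclidean_space \<Rightarrow> 'a) set \<Rightarrow> ('a \<Rightarrow> 'a) \<Rightarrow> ('a \<Rightarrow> 'a) \<Rightarrow> bool" where
  "covered_T W u w \<longleftrightarrow> le_T W u w \<and> u \<noteq> w \<and>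
     (\<forall>z. le_T W u z \<and> le_T W z w \<longrightarrow> z = u \<or> z = w)"

definition noncrossing_partitions ::
    "('a::euclidean_space \<Rightarrow> 'a) set \<Rightarrow> ('a \<Rightarrow> 'a) \<Rightarrow> ('a \<Rightarrow> 'a) set" where
  "noncrossing_partitions W c = {w \<in> W. le_T W w c}"

definition coxeter_element :: "nat \<Rightarrow> (nat \<Rightarrow> 'a::euclidean_space) \<Rightarrow> 'a \<Rightarrow> 'a" where
  "coxeter_element n \<alpha> = compose_list (map (\<lambda>i. R (\<alpha> i)) [1..<Suc n])"

definition mu :: "('a::euclidean_space \<Rightarrow> 'a) \<Rightarrow> 'a \<Rightarrow> 'a" where
  "mu c v = - 2 *\<^sub>R inv (\<lambda>x. c x - x) v"

text \<open>A saturated chain from the bottom \<open>e\<close> to the top \<open>c\<close> of the finite poset \<open>L\<close> is the same as a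
  maximal chain in \<open>L\<close>. The special simplex itself is the convex hull of the points
  \<open>w\<^sub>i(v\<^sub>0)\<close>; being special is a condition on the tuple \<open>(w\<^sub>0, \<dots>, w\<^sub>n)\<close> only.\<close>

definition special_simplex ::
    "('a::euclidean_space \<Rightarrow> 'a) set \<Rightarrow> nat \<Rightarrow> (nat \<Rightarrow> 'a) \<Rightarrow> (nat \<Rightarrow> 'a \<Rightarrow> 'a) \<Rightarrow> bool" where
  "special_simplex W n \<alpha> w \<longleftrightarrow>
     (let c = coxeter_element n \<alpha>; S = (\<lambda>i. R (\<alpha> i)) ` {1..n} in
       (\<forall>i\<le>n. w i \<in> W) \<and>
       (\<forall>i\<le>n. inv (w 0) \<circ> w i \<in> noncrossing_partitions W c) \<and>
       (\<forall>i<n. covered_T W (inv (w 0) \<circ> w i) (inv (w 0) \<circ> w (Suc i))) \<and>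
       inv (w 0) \<circ> w n = c \<and>
       (\<forall>i\<in>{1..n}. word_length S (w i) = word_length S (w 0) + i))"

end

theory Submission
  imports Defs
begin

text \<open>Put \<open>w\<^sub>j = w\<^sub>0 R(\<theta>\<^sub>1) \<dots> R(\<theta>\<^sub>j)\<close> and \<open>a\<^sub>j = v\<^sub>0 \<bullet> w\<^bsub>j-1\<^esub>(\<theta>\<^sub>j)\<close>. Applying the reflections one at a
  time to \<open>w\<^sub>0\<^sup>-\<^sup>1(v\<^sub>0)\<close> gives \<open>(c - I) w\<^sub>n\<^sup>-\<^sup>1(v\<^sub>0) = 2 \<Sum> a\<^sub>j \<theta>\<^sub>j\<close>, so the \<open>a\<^sub>j\<close> are the coordinates of
  \<open>w\<^sub>n\<^sup>-\<^sup>1(v\<^sub>0)\<close> in the basis \<open>-\<mu>(\<theta>\<^sub>j)\<close> and, applying \<open>c\<close>, those of \<open>w\<^sub>0\<^sup>-\<^sup>1(v\<^sub>0)\<close> in the basis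
  \<open>-\<mu>(c \<theta>\<^sub>j)\<close>. No \<open>a\<^sub>j\<close> vanishes because \<open>v\<^sub>0\<close> lies in an open chamber. By strong exchange,
  \<open>a\<^sub>j > 0\<close> says that \<open>l\<^sub>S\<close> increases from \<open>w\<^bsub>j-1\<^esub>\<close> to \<open>w\<^sub>j\<close>; the chain condition is automatic, as \<open>c\<close>
  fixes no nonzero vector and hence has reflection length \<open>n\<close>.\<close>

section \<open>Reflections and word lengths\<close>

lemma linear_R: "linear (R \<theta>)"
  unfolding R_def
  by (rule linearI) (simp_all add: inner_add_right algebra_simps add_divide_distrib)

lemma R_minus: "R (- \<theta>) = R \<theta>"
  by (simp add: R_def fun_eq_iff)

lemma R_self: "R \<theta> \<theta> = - \<theta>"
  by (cases "\<theta> = 0") (simp_all add: R_def scaleR_2)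

lemma R_unit: "norm \<theta> = 1 \<Longrightarrow> R \<theta> v = v - (2 * (\<theta> \<bullet> v)) *\<^sub>R \<theta>"
  by (simp add: R_def norm_eq_1)

lemma R_R: "R \<theta> (R \<theta> v) = v"
  by (cases "\<theta> = 0") (simp_all add: R_def inner_diff_right)

lemma R_comp_R: "R \<theta> \<circ> R \<theta> = id"
  by (simp add: fun_eq_iff R_R)

lemma inner_R_left: "R \<theta> x \<bullet> y = x \<bullet> R \<theta> y"
  by (simp add: R_def inner_diff_left inner_diff_right inner_commute)

lemma orthogonal_transformation_R: "orthogonal_transformation (R \<theta>)"
  by (simp add: orthogonal_transformation_def linear_R inner_R_left R_R)

lemma R_orthogonal_transformation:
  assumes "orthogonal_transformation g"
  shows "R (g \<theta>) (g x) = g (R \<theta> x)"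
  using assms
  by (simp add: R_def orthogonal_transformation_def linear_diff linear_scale)

text \<open>A reflection determines its (-1)-eigenline, and a line contains only two unit
  vectors.\<close>

lemma R_eq_unit_vectors:
  assumes "norm \<theta> = 1" "norm \<phi> = 1" "R \<theta> = R \<phi>"
  shows "\<phi> = \<theta> \<or> \<phi> = - \<theta>"
proof -
  have "R \<phi> \<theta> = - \<theta>"
    using assms(3) by (metis R_self)
  then have "2 *\<^sub>R \<theta> = 2 *\<^sub>R ((\<phi> \<bullet> \<theta>) *\<^sub>R \<phi>)"
    using assms(2) by (simp add: R_unit scaleR_2 algebra_simps)
  then have *: "\<theta> = (\<phi> \<bullet> \<theta>) *\<^sub>R \<phi>"
    by (simp only: scaleR_cancel_left) simp
  then have "\<bar>\<phi> \<bullet> \<theta>\<bar> = 1"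
    using assms by (metis mult_cancel_left2 norm_scaleR mult.right_neutral)
  then show ?thesis
    using * by (metis abs_eq_iff abs_one minus_minus scaleR_minus1_left scaleR_one)
qed

section \<open>Products of lists of maps and word length\<close>

lemma compose_list_Nil [simp]: "compose_list [] = id"
  by (simp add: compose_list_def)

lemma compose_list_Cons [simp]: "compose_list (f # fs) = f \<circ> compose_list fs"
  by (simp add: compose_list_def)

lemma compose_list_append: "compose_list (fs @ gs) = compose_list fs \<circ> compose_list gs"
  by (induction fs) (simp_all add: comp_assoc)

lemma compose_list_rev_involutions:
  assumes "\<forall>f\<in>set fs. f \<circ> f = id"
  shows "compose_list fs \<circ> compose_list (rev fs) = id"
  using assms
proof (induction fs)
  case (Cons f fs)
  have "compose_list (f # fs) \<circ> compose_list (rev (f # fs))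
      = f \<circ> (compose_list fs \<circ> compose_list (rev fs)) \<circ> f"
    by (simp add: compose_list_append comp_assoc)
  also have "compose_list fs \<circ> compose_list (rev fs) = id"
    using Cons.prems by (intro Cons.IH) simp
  finally show ?case
    using Cons.prems by simp
qed simp

lemma orthogonal_transformation_compose_list:
  assumes "\<forall>f\<in>set fs. orthogonal_transformation f"
  shows "orthogonal_transformation (compose_list fs)"
  using assms
  by (induction fs) (simp_all add: orthogonal_transformation_compose id_def)

lemma word_length_le:
  "set fs \<subseteq> A \<Longrightarrow> word_length A (compose_list fs) \<le> length fs"
  unfolding word_length_def by (rule Least_le) blast

lemma word_length_attained:
  assumes "set fs \<subseteq> A"
  obtains gs where "set gs \<subseteq> A" "length gs = word_length A (compose_list fs)"
    "compose_list gs = compose_list fs"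
proof -
  have "\<exists>m gs. set gs \<subseteq> A \<and> length gs = m \<and> compose_list gs = compose_list fs"
    using assms by blast
  from LeastI_ex[OF this] show thesis
    using that unfolding word_length_def by blast
qed

lemma word_length_comp_le:
  assumes "set fs \<subseteq> A" "set gs \<subseteq> A"
  shows "word_length A (compose_list fs \<circ> compose_list gs)
    \<le> word_length A (compose_list fs) + word_length A (compose_list gs)"
proof -
  obtain fs' where fs': "set fs' \<subseteq> A" "length fs' = word_length A (compose_list fs)"
    "compose_list fs' = compose_list fs"
    using word_length_attained[OF assms(1)] .
  obtain gs' where gs': "set gs' \<subseteq> A" "length gs' = word_length A (compose_list gs)"
    "compose_list gs' = compose_list gs"
    using word_length_attained[OF assms(2)] .
  have "word_length A (compose_list (fs' @ gs')) \<le> length (fs' @ gs')"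
    using fs' gs' by (intro word_length_le) simp
  then show ?thesis
    using fs' gs' by (simp add: compose_list_append)
qed

section \<open>The reflection group and its roots\<close>

locale reflection_group =
  fixes W :: "('a::euclidean_space \<Rightarrow> 'a) set"
  assumes frg: "finite_reflection_group W"
begin

lemma W_word: "w \<in> W \<Longrightarrow> \<exists>ts. set ts \<subseteq> reflections W \<and> w = compose_list ts"
  using frg unfolding finite_reflection_group_def by blast

lemma compose_reflections_mem: "set ts \<subseteq> reflections W \<Longrightarrow> compose_list ts \<in> W"
  using frg unfolding finite_reflection_group_def by blast

lemma W_id: "id \<in> W"
  using compose_reflections_mem[of "[]"] by simp

lemma W_comp:
  assumes "v \<in> W" "w \<in> W"
  shows "v \<circ> w \<in> W"
proof -
  obtain fs gs where "set fs \<subseteq> reflections W" "v = compose_list fs"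
    "set gs \<subseteq> reflections W" "w = compose_list gs"
    using assms W_word by metis
  then show ?thesis
    using compose_reflections_mem[of "fs @ gs"] by (simp add: compose_list_append)
qed

lemma W_compose_list: "set ws \<subseteq> W \<Longrightarrow> compose_list ws \<in> W"
  by (induction ws) (simp_all add: W_id W_comp)

lemma W_orthogonal:
  assumes "w \<in> W"
  shows "orthogonal_transformation w"
proof -
  obtain ts where "set ts \<subseteq> reflections W" "w = compose_list ts"
    using W_word assms by blast
  then show ?thesis
    by (auto simp: reflections_def intro!: orthogonal_transformation_compose_list
        orthogonal_transformation_R)
qed

lemma W_bij: "w \<in> W \<Longrightarrow> bij w"
  using W_orthogonal orthogonal_transformation_bij by blast

lemma W_linear: "w \<in> W \<Longrightarrow> linear w"
  using W_orthogonal orthogonal_transformation_linear by blast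

lemma W_inv_right: "w \<in> W \<Longrightarrow> w (inv w x) = x"
  by (meson W_bij bij_inv_eq_iff)

lemma W_inv_left: "w \<in> W \<Longrightarrow> inv w (w x) = x"
  using W_bij[of w] by (simp add: bij_is_inj)

lemma W_inv:
  assumes "w \<in> W"
  shows "inv w \<in> W"
proof -
  obtain ts where ts: "set ts \<subseteq> reflections W" "w = compose_list ts"
    using W_word assms by blast
  have *: "\<forall>f\<in>set ts. f \<circ> f = id"
    using ts by (auto simp: reflections_def R_comp_R)
  have "w \<circ> compose_list (rev ts) = id" "compose_list (rev ts) \<circ> w = id"
    using compose_list_rev_involutions[OF *] compose_list_rev_involutions[of "rev ts"] * ts
    by simp_all
  then have "inv w = compose_list (rev ts)"
    by (metis inv_unique_comp)
  then show ?thesis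
    using ts compose_reflections_mem[of "rev ts"] by simp
qed

lemma inner_W_inv: "w \<in> W \<Longrightarrow> inv w x \<bullet> y = x \<bullet> w y"
  by (metis W_inv_right W_orthogonal orthogonal_transformation_def)

lemma root_norm: "\<theta> \<in> roots W \<Longrightarrow> norm \<theta> = 1"
  by (simp add: roots_def)

lemma root_nonzero: "\<theta> \<in> roots W \<Longrightarrow> \<theta> \<noteq> 0"
  by (auto simp: roots_def)

lemma R_root_mem: "\<theta> \<in> roots W \<Longrightarrow> R \<theta> \<in> W"
  by (simp add: roots_def)

lemma R_root_reflections: "\<theta> \<in> roots W \<Longrightarrow> R \<theta> \<in> reflections W"
  using root_nonzero by (auto simp: roots_def reflections_def)

lemma reflections_root:
  assumes "t \<in> reflections W"
  obtains \<theta> where "\<theta> \<in> roots W" "t = R \<theta>"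
proof -
  obtain \<theta> where \<theta>: "t \<in> W" "\<theta> \<noteq> 0" "t = R \<theta>"
    using assms by (auto simp: reflections_def)
  have "R (\<theta> /\<^sub>R norm \<theta>) = R \<theta>"
    using \<theta>(2) by (auto simp: R_def fun_eq_iff field_simps norm_eq_sqrt_inner)
  then show thesis
    using that[of "\<theta> /\<^sub>R norm \<theta>"] \<theta> by (auto simp: roots_def)
qed

lemma root_minus: "\<theta> \<in> roots W \<Longrightarrow> - \<theta> \<in> roots W"
  by (simp add: roots_def R_minus)

text \<open>This is the rule for conjugating a reflection, kept free of \<open>inv\<close> so that
  it rewrites compositions directly.\<close>

lemma R_image: "w \<in> W \<Longrightarrow> R (w \<theta>) \<circ> w = w \<circ> R \<theta>"
  by (simp add: fun_eq_iff R_orthogonal_transformation W_orthogonal)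

lemma root_image:
  assumes "w \<in> W" "\<theta> \<in> roots W"
  shows "w \<theta> \<in> roots W"
proof -
  have "R (w \<theta>) = (w \<circ> R \<theta>) \<circ> inv w"
    using R_image[OF assms(1), of \<theta>] assms(1)
    by (metis W_bij bij_is_surj comp_assoc comp_id surj_iff)
  then have "R (w \<theta>) \<in> W"
    using assms by (simp add: W_comp W_inv R_root_mem)
  moreover have "norm (w \<theta>) = 1"
    using assms W_orthogonal root_norm by (simp add: orthogonal_transformation)
  ultimately show ?thesis
    by (simp add: roots_def)
qed

text \<open>Each of the finitely many elements of \<open>W\<close> is the reflection in at most two
  unit vectors.\<close>

lemma finite_roots: "finite (roots W)"
proof -
  have "finite {\<theta>. norm \<theta> = 1 \<and> R \<theta> = w}" for w :: "'a \<Rightarrow> 'a"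
  proof (cases "\<exists>\<phi>. norm \<phi> = 1 \<and> R \<phi> = w")
    case True
    then obtain \<phi> where "norm \<phi> = 1" "R \<phi> = w"
      by blast
    then have "{\<theta>. norm \<theta> = 1 \<and> R \<theta> = w} \<subseteq> {\<phi>, - \<phi>}"
      using R_eq_unit_vectors by fastforce
    then show ?thesis
      by (rule finite_subset) simp
  next
    case False
    then have "{\<theta>. norm \<theta> = 1 \<and> R \<theta> = w} = {}"
      by blast
    then show ?thesis
      by (metis finite.emptyI)
  qed
  moreover have "roots W = (\<Union>w\<in>W. {\<theta>. norm \<theta> = 1 \<and> R \<theta> = w})"
    by (auto simp: roots_def)
  moreover have "finite W"
    using frg by (simp add: finite_reflection_group_def)
  ultimately show ?thesis
    by simp
qed

end

section \<open>Chambers\<close>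

context reflection_group
begin

text \<open>A chamber is connected and misses the hyperplane of \<open>\<theta>\<close>, so the
  intermediate value theorem excludes a change of sign.\<close>

lemma chamber_root_sign:
  assumes C: "C \<in> chambers W" and \<theta>: "\<theta> \<in> roots W"
  shows "(\<forall>x\<in>C. \<theta> \<bullet> x > 0) \<or> (\<forall>x\<in>C. \<theta> \<bullet> x < 0)"
proof (rule ccontr)
  assume neg: "\<not> ?thesis"
  have nz: "\<theta> \<bullet> x \<noteq> 0" if "x \<in> C" for x
    using in_components_subset[OF C[unfolded chambers_def]] that \<theta> by auto
  obtain x y where "x \<in> C" "y \<in> C" "\<theta> \<bullet> x \<le> 0" "0 \<le> \<theta> \<bullet> y"
    using neg by (meson not_less)
  then obtain z where "z \<in> C" "\<theta> \<bullet> z = 0"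
    using connected_ivt_hyperplane[of C x y \<theta> 0]
      in_components_connected[OF C[unfolded chambers_def]] by blast
  then show False
    using nz by blast
qed

text \<open>The intersection of the open half-spaces is convex, hence connected; it avoids every
  reflecting hyperplane and meets \<open>C\<close>, so it lies in the component
  \<open>C\<close>.\<close>

lemma chamber_eq:
  assumes C: "C \<in> chambers W"
  defines "\<Phi> \<equiv> {\<theta> \<in> roots W. \<forall>x\<in>C. \<theta> \<bullet> x > 0}"
  shows "C = {x. \<forall>\<theta>\<in>\<Phi>. \<theta> \<bullet> x > 0}"
proof
  let ?D = "{x. \<forall>\<theta>\<in>\<Phi>. \<theta> \<bullet> x > 0}"
  show "C \<subseteq> ?D"
    by (auto simp: \<Phi>_def)
  have "convex ?D"
  proof -
    have "?D = (\<Inter>\<theta>\<in>\<Phi>. {x. \<theta> \<bullet> x > 0})"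
      by blast
    then show ?thesis
      by (simp add: convex_INT convex_halfspace_gt)
  qed
  moreover have "?D \<subseteq> - (\<Union>\<theta>\<in>roots W. {v. \<theta> \<bullet> v = 0})"
  proof clarify
    fix x \<theta>
    assume x: "\<forall>\<theta>\<in>\<Phi>. \<theta> \<bullet> x > 0" and \<theta>: "\<theta> \<in> roots W" "\<theta> \<bullet> x = 0"
    have "\<theta> \<in> \<Phi> \<or> - \<theta> \<in> \<Phi>"
      using chamber_root_sign[OF C \<theta>(1)] \<theta>(1) root_minus[OF \<theta>(1)] by (auto simp: \<Phi>_def)
    then have "\<theta> \<bullet> x > 0 \<or> - \<theta> \<bullet> x > 0"
      using x by blast
    then show False
      using \<theta>(2) by simp
  qed
  moreover have "C \<inter> ?D \<noteq> {}"
    using in_components_nonempty[OF C[unfolded chambers_def]] \<open>C \<subseteq> ?D\<close> by blast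
  ultimately show "?D \<subseteq> C"
    using components_maximal[OF C[unfolded chambers_def]] convex_connected by blast
qed

text \<open>A point satisfying the weak inequalities is a limit of chamber points: adding a small
  positive multiple of a chamber point makes all of them strict.\<close>

lemma closure_chamber:
  assumes C: "C \<in> chambers W"
  defines "\<Phi> \<equiv> {\<theta> \<in> roots W. \<forall>x\<in>C. \<theta> \<bullet> x > 0}"
  shows "closure C = {x. \<forall>\<theta>\<in>\<Phi>. \<theta> \<bullet> x \<ge> 0}"
proof
  have "{x. \<forall>\<theta>\<in>\<Phi>. \<theta> \<bullet> x \<ge> 0} = (\<Inter>\<theta>\<in>\<Phi>. {x. \<theta> \<bullet> x \<ge> 0})"
    by blast
  then have "closed {x. \<forall>\<theta>\<in>\<Phi>. \<theta> \<bullet> x \<ge> 0}"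
    by (simp add: closed_INT closed_halfspace_ge)
  moreover have "C \<subseteq> {x. \<forall>\<theta>\<in>\<Phi>. \<theta> \<bullet> x \<ge> 0}"
    by (auto simp: \<Phi>_def intro: less_imp_le)
  ultimately show "closure C \<subseteq> {x. \<forall>\<theta>\<in>\<Phi>. \<theta> \<bullet> x \<ge> 0}"
    by (simp add: closure_minimal)
  show "{x. \<forall>\<theta>\<in>\<Phi>. \<theta> \<bullet> x \<ge> 0} \<subseteq> closure C"
  proof
    fix x
    assume x: "x \<in> {x. \<forall>\<theta>\<in>\<Phi>. \<theta> \<bullet> x \<ge> 0}"
    obtain y where y: "y \<in> C"
      using in_components_nonempty[OF C[unfolded chambers_def]] by blast
    have mem: "x + (1 / real (Suc k)) *\<^sub>R y \<in> C" for k
    proof -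
      have "\<theta> \<bullet> (x + (1 / real (Suc k)) *\<^sub>R y) > 0" if "\<theta> \<in> \<Phi>" for \<theta>
        using x y that by (auto simp: inner_add_right \<Phi>_def intro!: add_nonneg_pos)
      then show ?thesis
        using chamber_eq[OF C] unfolding \<Phi>_def by blast
    qed
    have "(\<lambda>k. x + (1 / real (Suc k)) *\<^sub>R y) \<longlonglongrightarrow> x + 0 *\<^sub>R y"
      using LIMSEQ_inverse_real_of_nat unfolding inverse_eq_divide
      by (intro tendsto_add tendsto_const tendsto_scaleR)
    then show "x \<in> closure C"
      using mem unfolding closure_sequential
      by (intro exI[of _ "\<lambda>k. x + (1 / real (Suc k)) *\<^sub>R y"]) simp
  qed
qed

text \<open>Take \<open>G\<close> as an inclusion-minimal set of roots that cuts out the closed chamber.\<close>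

lemma closure_chamber_inward_normals:
  assumes C: "C \<in> chambers W"
  obtains G where "G \<subseteq> roots W" "G \<subseteq> inward_unit_normals C"
    "closure C = {x. \<forall>g\<in>G. g \<bullet> x \<ge> 0}"
proof -
  define \<Phi> where "\<Phi> = {\<theta> \<in> roots W. \<forall>x\<in>C. \<theta> \<bullet> x > 0}"
  have fin: "finite \<Phi>"
    using finite_roots by (simp add: \<Phi>_def)
  let ?P = "\<lambda>G. G \<subseteq> \<Phi> \<and> closure C = {x. \<forall>g\<in>G. g \<bullet> x \<ge> 0}"
  have "?P \<Phi>"
    using closure_chamber[OF C] by (simp add: \<Phi>_def)
  \<comment> \<open>Least cardinality gives the minimality: dropping any single \<open>g\<close>
    then changes the region.\<close>
  then obtain G where G: "?P G" and min: "\<And>H. ?P H \<Longrightarrow> card G \<le> card H"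
    using ex_has_least_nat[of ?P \<Phi> card] by blast
  have finG: "finite G"
    using G fin finite_subset by blast
  obtain x0 where x0: "x0 \<in> C"
    using in_components_nonempty[OF C[unfolded chambers_def]] by blast
  have "open C"
  proof -
    have "open (- (\<Union>\<theta>\<in>roots W. {v. \<theta> \<bullet> v = 0}))"
      using finite_roots by (intro open_Compl closed_UN) (simp_all add: closed_hyperplane)
    then show ?thesis
      using C open_components unfolding chambers_def by blast
  qed
  then have "interior (closure C) \<noteq> {}"
    using x0 by (metis closure_subset empty_iff interior_maximal subsetD)
  then have dimC: "aff_dim (closure C) = DIM('a)"
    by (rule aff_dim_nonempty_interior)
  have "g \<in> inward_unit_normals C" if g: "g \<in> G" for g
  proof -
    have gpos: "norm g = 1" "\<forall>x\<in>C. g \<bullet> x > 0" "g \<noteq> 0"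
      using g G by (auto simp: \<Phi>_def roots_def)
    \<comment> \<open>By minimality some point \<open>y\<close> violates the inequality of
      \<open>g\<close> and no other.\<close>
    have "\<not> ?P (G - {g})"
      using min[of "G - {g}"] card_Diff1_less[OF finG g] by linarith
    then obtain y where y: "\<forall>h\<in>G - {g}. h \<bullet> y \<ge> 0" "\<not> g \<bullet> y \<ge> 0"
      using G by auto
    \<comment> \<open>\<open>t\<close> is chosen so that \<open>y + t *\<^sub>R x0\<close> lies on
      the hyperplane of \<open>g\<close>. As \<open>t > 0\<close>, the other inequalities become
      strict at that point.\<close>
    define t where "t = - (g \<bullet> y) / (g \<bullet> x0)"
    define F where "F = closure C \<inter> {x. g \<bullet> x = 0}"
    \<comment> \<open>\<open>F'\<close> is a nonempty relatively open piece of the hyperplane, so it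
      has full dimension there. Since \<open>F\<close> contains it, the face \<open>F\<close> is a
      facet.\<close>
    define F' where "F' = {x. g \<bullet> x = 0} \<inter> (\<Inter>h\<in>G - {g}. {x. h \<bullet> x > 0})"
    have gx0: "g \<bullet> x0 > 0"
      using gpos x0 by blast
    then have t: "t > 0"
      using y by (simp add: t_def divide_neg_pos)
    have "y + t *\<^sub>R x0 \<in> F'"
    proof -
      have "h \<bullet> x0 > 0" if "h \<in> G" for h
        using that G x0 by (auto simp: \<Phi>_def)
      then have "h \<bullet> (y + t *\<^sub>R x0) > 0" if "h \<in> G - {g}" for h
        using that y t by (auto simp: inner_add_right intro!: add_nonneg_pos)
      moreover have "g \<bullet> (y + t *\<^sub>R x0) = 0"
        using gx0 by (simp add: inner_add_right inner_diff_right t_def)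
      ultimately show ?thesis
        by (simp add: F'_def)
    qed
    moreover have "openin (top_of_set {x. g \<bullet> x = 0}) F'"
      using finG unfolding F'_def
      by (intro openin_open_Int open_INT) (simp_all add: open_halfspace_gt)
    ultimately have "aff_dim F' = aff_dim {x. g \<bullet> x = 0}"
      by (intro aff_dim_openin[of "{x. g \<bullet> x = 0}"]) (auto simp: affine_hyperplane)
    then have "aff_dim F' = int DIM('a) - 1"
      using aff_dim_hyperplane[OF gpos(3), of 0] by simp
    moreover have "F' \<subseteq> F"
    proof
      fix x
      assume x: "x \<in> F'"
      then have "h \<bullet> x \<ge> 0" if "h \<in> G" for h
        using that by (cases "h = g") (auto simp: F'_def intro: less_imp_le)
      then show "x \<in> F"
        using x G by (simp add: F_def F'_def)
    qed
    moreover have "aff_dim F \<le> int DIM('a) - 1"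
      using aff_dim_subset[of F "{x. g \<bullet> x = 0}"] aff_dim_hyperplane[OF gpos(3), of 0]
      by (auto simp: F_def)
    ultimately have "aff_dim F = aff_dim (closure C) - 1"
      using aff_dim_subset[of F' F] dimC by linarith
    moreover have "F face_of closure C"
    proof -
      have "convex C"
      proof -
        have "C = (\<Inter>\<theta>\<in>\<Phi>. {x. \<theta> \<bullet> x > 0})"
          using chamber_eq[OF C] by (auto simp: \<Phi>_def)
        moreover have "convex (\<Inter>\<theta>\<in>\<Phi>. {x. \<theta> \<bullet> x > 0})"
          by (simp add: convex_INT convex_halfspace_gt)
        ultimately show ?thesis
          by (rule ssubst)
      qed
      moreover have "g \<bullet> x \<ge> 0" if "x \<in> closure C" for x
        using that G g by blast
      ultimately show ?thesis
        unfolding F_def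
        by (intro face_of_Int_supporting_hyperplane_ge convex_closure)
    qed
    moreover have "F \<noteq> {}"
      using \<open>y + t *\<^sub>R x0 \<in> F'\<close> \<open>F' \<subseteq> F\<close> by blast
    ultimately show ?thesis
      using gpos unfolding inward_unit_normals_def facet_of_def F_def by blast
  qed
  then show thesis
    using that[of G] G by (auto simp: \<Phi>_def)
qed

end

section \<open>Simple systems and strong exchange\<close>

lemma span_eq_UNIV_if_orthogonal_zero:
  fixes A :: "'a::euclidean_space set"
  assumes "\<And>x. (\<forall>a\<in>A. a \<bullet> x = 0) \<Longrightarrow> x = 0"
  shows "span A = UNIV"
proof (rule ccontr)
  assume "span A \<noteq> UNIV"
  then obtain x where "x \<noteq> 0" "\<forall>y\<in>span A. x \<bullet> y = 0"
    using span_not_univ_subset_hyperplane[of A] by auto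
  then show False
    using assms[of x] span_base by (metis inner_commute)
qed

text \<open>Each reflection subtracts a multiple of its own unit vector, with a coefficient taken at
  the current intermediate point.\<close>

lemma R_chain_expansion:
  assumes "\<And>j. j < n \<Longrightarrow> y (Suc j) = R (\<theta> (Suc j)) (y j)"
    and "\<And>j. j \<in> {1..n} \<Longrightarrow> norm (\<theta> j) = 1"
  shows "y n = y 0 - 2 *\<^sub>R (\<Sum>j=1..n. (\<theta> j \<bullet> y (j - 1)) *\<^sub>R \<theta> j)"
  using assms
proof (induction n)
  case (Suc n)
  then have "y (Suc n) = y n - (2 * (\<theta> (Suc n) \<bullet> y n)) *\<^sub>R \<theta> (Suc n)"
    by (simp add: R_unit)
  moreover have "y n = y 0 - 2 *\<^sub>R (\<Sum>j=1..n. (\<theta> j \<bullet> y (j - 1)) *\<^sub>R \<theta> j)"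
    using Suc by simp
  ultimately show ?case
    by (simp add: scaleR_right_distrib diff_diff_eq)
qed simp

lemma compose_list_R_fixes_orthogonal:
  "(\<And>\<theta>. \<theta> \<in> set \<theta>s \<Longrightarrow> \<theta> \<bullet> v = 0) \<Longrightarrow> compose_list (map R \<theta>s) v = v"
  by (induction \<theta>s) (auto simp: R_def)

text \<open>Membership in the cone supplies some nonnegative coefficients; independence forces them
  to be the given ones.\<close>

lemma nonneg_cone_image_independent:
  fixes f :: "nat \<Rightarrow> 'a::real_vector"
  assumes "independent (f ` I)" "inj_on f I" "finite I"
  shows "(\<Sum>i\<in>I. a i *\<^sub>R f i) \<in> nonneg_cone (f ` I) \<longleftrightarrow> (\<forall>i\<in>I. a i \<ge> 0)"
proof
  assume "\<forall>i\<in>I. a i \<ge> 0"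
  \<comment> \<open>\<open>nonneg_cone\<close> indexes coefficients by vectors, so injectivity of
    \<open>f\<close> is used to pass from indices to vectors.\<close>
  then have "(\<Sum>i\<in>I. a i *\<^sub>R f i) = (\<Sum>x\<in>f ` I. a (the_inv_into I f x) *\<^sub>R x)"
    "\<forall>x\<in>f ` I. a (the_inv_into I f x) \<ge> 0"
    using assms(2) by (simp_all add: sum.reindex the_inv_into_f_f)
  then show "(\<Sum>i\<in>I. a i *\<^sub>R f i) \<in> nonneg_cone (f ` I)"
    unfolding nonneg_cone_def using assms(3)
    by (intro CollectI exI[of _ "f ` I"] exI[of _ "\<lambda>x. a (the_inv_into I f x)"]) simp
next
  assume "(\<Sum>i\<in>I. a i *\<^sub>R f i) \<in> nonneg_cone (f ` I)"
  then obtain F g where F: "finite F" "F \<subseteq> f ` I" "\<forall>x\<in>F. g x \<ge> 0"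
    "(\<Sum>i\<in>I. a i *\<^sub>R f i) = (\<Sum>x\<in>F. g x *\<^sub>R x)"
    unfolding nonneg_cone_def by blast
  \<comment> \<open>Extension by zero lets both sums run over the whole family.\<close>
  define b where "b x = (if x \<in> F then g x else 0)" for x
  have "(\<Sum>x\<in>F. g x *\<^sub>R x) = (\<Sum>x\<in>f ` I. b x *\<^sub>R x)"
    using F assms(3) by (intro sum.mono_neutral_cong_left) (auto simp: b_def)
  also have "\<dots> = (\<Sum>i\<in>I. b (f i) *\<^sub>R f i)"
    using assms(2) by (simp add: sum.reindex)
  finally have "(\<Sum>i\<in>I. (a i - b (f i)) *\<^sub>R f i) = 0"
    using F(4) by (simp add: scaleR_left_diff_distrib sum_subtractf)
  then have "(\<Sum>x\<in>f ` I. (a (the_inv_into I f x) - b x) *\<^sub>R x) = 0"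
    using assms(2) by (simp add: sum.reindex the_inv_into_f_f)
  then have "\<forall>x\<in>f ` I. a (the_inv_into I f x) - b x = 0"
    using independentD[OF assms(1) finite_imageI[OF assms(3)] order_refl,
        of "\<lambda>x. a (the_inv_into I f x) - b x"] by blast
  then have "\<forall>i\<in>I. a i = b (f i)"
    using assms(2) by (simp add: the_inv_into_f_f)
  then show "\<forall>i\<in>I. a i \<ge> 0"
    using F(3) by (simp add: b_def)
qed

text \<open>A spanning family of as many vectors as the dimension can have neither repetitions nor
  linear relations.\<close>

lemma spanning_image_atLeastAtMost:
  fixes f :: "nat \<Rightarrow> 'a::euclidean_space"
  assumes "span (f ` {1..n}) = UNIV" "n = DIM('a)"
  shows "independent (f ` {1..n})" "inj_on f {1..n}"
proof -
  have "card (f ` {1..n}) \<le> n"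
    using card_image_le[of "{1..n}" f] by simp
  then show ind: "independent (f ` {1..n})"
    using assms by (intro card_le_dim_spanning[where V = UNIV]) simp_all
  then have "card (f ` {1..n}) = n"
    using assms by (metis dim_UNIV dim_eq_card_independent dim_span)
  then show "inj_on f {1..n}"
    by (intro eq_card_imp_inj_on) simp_all
qed

lemma nonneg_cone_eq_dual:
  fixes \<alpha> \<beta> :: "nat \<Rightarrow> 'a::euclidean_space"
  assumes dual: "\<And>i j. i \<in> {1..n} \<Longrightarrow> j \<in> {1..n} \<Longrightarrow> \<beta> i \<bullet> \<alpha> j = (if i = j then 1 else 0)"
    and x: "x \<in> nonneg_cone (\<alpha> ` {1..n})" and i: "i \<in> {1..n}"
  shows "\<beta> i \<bullet> x \<ge> 0"
proof -
  have "\<beta> i \<bullet> a \<ge> 0" if "a \<in> \<alpha> ` {1..n}" for a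
    using that dual[OF i] by auto
  then show ?thesis
    using x unfolding nonneg_cone_def
    by (force simp: inner_sum_right intro!: sum_nonneg mult_nonneg_nonneg)
qed

text \<open>This isolates what the length arguments use: the simple vectors are roots, and the
  coordinates \<open>\<beta> i \<bullet> \<theta>\<close> of a root in the simple basis share one
  sign. The chamber enters only through \<open>simple_system_of_chamber\<close>.\<close>

locale simple_system = reflection_group W
  for W :: "('a::euclidean_space \<Rightarrow> 'a) set" +
  fixes n :: nat and \<alpha> \<beta> :: "nat \<Rightarrow> 'a"
  assumes n: "n = DIM('a)"
    and \<alpha>_root: "i \<in> {1..n} \<Longrightarrow> \<alpha> i \<in> roots W"
    and dual: "i \<in> {1..n} \<Longrightarrow> j \<in> {1..n} \<Longrightarrow> \<beta> i \<bullet> \<alpha> j = (if i = j then 1 else 0)"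
    and root_sign: "\<theta> \<in> roots W \<Longrightarrow>
      (\<forall>i\<in>{1..n}. \<beta> i \<bullet> \<theta> \<ge> 0) \<or> (\<forall>i\<in>{1..n}. \<beta> i \<bullet> \<theta> \<le> 0)"
begin

definition v0 :: 'a where "v0 = (\<Sum>i=1..n. \<beta> i)"

definition S :: "('a \<Rightarrow> 'a) set" where "S = (\<lambda>i. R (\<alpha> i)) ` {1..n}"

definition c :: "'a \<Rightarrow> 'a" where "c = coxeter_element n \<alpha>"

lemma \<beta>_sum_\<alpha>:
  assumes "i \<in> {1..n}"
  shows "\<beta> i \<bullet> (\<Sum>j=1..n. a j *\<^sub>R \<alpha> j) = a i"
proof -
  have "\<beta> i \<bullet> (\<Sum>j=1..n. a j *\<^sub>R \<alpha> j) = (\<Sum>j=1..n. if i = j then a j else 0)"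
    unfolding inner_sum_right using dual[OF assms] by (intro sum.cong) auto
  then show ?thesis
    using assms by simp
qed

lemma inj_\<alpha>: "inj_on \<alpha> {1..n}"
  using dual by (intro inj_onI) (metis zero_neq_one)

lemma span_\<alpha>: "span (\<alpha> ` {1..n}) = UNIV"
proof -
  have "independent (\<alpha> ` {1..n})"
  proof (subst independent_explicit_finite_subsets, intro allI impI ballI)
    fix A u x
    assume A: "A \<subseteq> \<alpha> ` {1..n}" "finite A" "(\<Sum>v\<in>A. u v *\<^sub>R v) = 0" "x \<in> A"
    obtain i where i: "i \<in> {1..n}" "x = \<alpha> i"
      using A by blast
    have "\<beta> i \<bullet> v = (if v = x then 1 else 0)" if "v \<in> A" for v
      using that A(1) i dual inj_\<alpha> by (auto simp: inj_on_eq_iff)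
    then have "\<beta> i \<bullet> (\<Sum>v\<in>A. u v *\<^sub>R v) = (\<Sum>v\<in>A. if v = x then u v else 0)"
      unfolding inner_sum_right by (intro sum.cong) auto
    then show "u x = 0"
      using A by simp
  qed
  moreover have "card (\<alpha> ` {1..n}) = DIM('a)"
    using inj_\<alpha> n by (simp add: card_image)
  ultimately show ?thesis
    by (metis UNIV_I dim_UNIV card_eq_dim independent_imp_finite subsetI subset_antisym
        card_ge_dim_independent subset_UNIV order_refl)
qed

lemma \<alpha>_expansion: "x = (\<Sum>i=1..n. (\<beta> i \<bullet> x) *\<^sub>R \<alpha> i)"
proof -
  have "x \<in> span (\<alpha> ` {1..n})"
    using span_\<alpha> by simp
  then obtain u where "x = (\<Sum>v\<in>\<alpha> ` {1..n}. u v *\<^sub>R v)"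
    using span_finite[of "\<alpha> ` {1..n}"] by auto
  then have x: "x = (\<Sum>i=1..n. u (\<alpha> i) *\<^sub>R \<alpha> i)"
    using inj_\<alpha> by (simp add: sum.reindex)
  then have "\<beta> i \<bullet> x = u (\<alpha> i)" if "i \<in> {1..n}" for i
    using \<beta>_sum_\<alpha>[OF that] by simp
  then have "(\<Sum>i=1..n. (\<beta> i \<bullet> x) *\<^sub>R \<alpha> i) = (\<Sum>i=1..n. u (\<alpha> i) *\<^sub>R \<alpha> i)"
    by (intro sum.cong) simp_all
  then show ?thesis
    using x by (rule trans[OF _ sym, rotated])
qed

lemma \<beta>_orthogonal_imp_0: "(\<And>i. i \<in> {1..n} \<Longrightarrow> \<beta> i \<bullet> x = 0) \<Longrightarrow> x = 0"
  by (subst \<alpha>_expansion) simp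

text \<open>Pairing with \<open>v0\<close> adds up the coordinates in the simple basis and so serves
  as a height function on roots, whose sign tests positivity.\<close>

lemma v0_inner: "v0 \<bullet> x = (\<Sum>i=1..n. \<beta> i \<bullet> x)"
  by (simp add: v0_def inner_sum_left)

lemma v0_inner_pos:
  assumes "\<forall>i\<in>{1..n}. \<beta> i \<bullet> x \<ge> 0" "x \<noteq> 0"
  shows "v0 \<bullet> x > 0"
proof -
  obtain i where "i \<in> {1..n}" "\<beta> i \<bullet> x \<noteq> 0"
    using \<beta>_orthogonal_imp_0 assms(2) by blast
  then have "(\<Sum>i=1..n. \<beta> i \<bullet> x) > 0"
    using assms(1) by (intro sum_pos2[of _ i]) (auto simp: less_le)
  then show ?thesis
    by (simp add: v0_inner)
qed

text \<open>\<open>v0\<close> lies on no reflecting hyperplane. This later reconciles the strict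
  inequalities from lengths with the weak ones from cones.\<close>

lemma v0_root_nonzero: "\<theta> \<in> roots W \<Longrightarrow> v0 \<bullet> \<theta> \<noteq> 0"
  using root_sign[of \<theta>] v0_inner_pos[of \<theta>] v0_inner_pos[of "- \<theta>"] root_nonzero[of \<theta>] by force

lemma v0_root_pos_iff:
  assumes "\<theta> \<in> roots W"
  shows "v0 \<bullet> \<theta> > 0 \<longleftrightarrow> (\<forall>i\<in>{1..n}. \<beta> i \<bullet> \<theta> \<ge> 0)"
proof -
  have "v0 \<bullet> \<theta> \<le> 0" if "\<forall>i\<in>{1..n}. \<beta> i \<bullet> \<theta> \<le> 0"
    using that unfolding v0_inner by (intro sum_nonpos) simp
  then show ?thesis
    using v0_inner_pos[of \<theta>] root_sign[OF assms] root_nonzero[OF assms] by force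
qed

lemma \<beta>_R_\<alpha>:
  assumes "i \<in> {1..n}" "j \<in> {1..n}" "i \<noteq> j"
  shows "\<beta> i \<bullet> R (\<alpha> j) x = \<beta> i \<bullet> x"
  using assms by (simp add: R_def inner_diff_right dual)

text \<open>The reflection in \<open>\<alpha> i\<close> alters only the coordinate at
  \<open>i\<close>. If the root changes sign, all its other coordinates vanish, and unit length
  leaves only \<open>\<alpha> i\<close>.\<close>

lemma simple_reflection_makes_negative:
  assumes i: "i \<in> {1..n}" and \<theta>: "\<theta> \<in> roots W"
    and pos: "v0 \<bullet> \<theta> > 0" and neg: "v0 \<bullet> R (\<alpha> i) \<theta> < 0"
  shows "\<theta> = \<alpha> i"
proof -
  have root: "R (\<alpha> i) \<theta> \<in> roots W"
    using i \<theta> by (simp add: root_image R_root_mem \<alpha>_root)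
  have nonneg: "\<forall>j\<in>{1..n}. \<beta> j \<bullet> \<theta> \<ge> 0"
    using pos \<theta> by (simp add: v0_root_pos_iff)
  have "\<forall>j\<in>{1..n}. \<beta> j \<bullet> R (\<alpha> i) \<theta> \<le> 0"
    using neg root_sign[OF root] v0_root_pos_iff[OF root] by linarith
  then have zero: "\<beta> j \<bullet> \<theta> = 0" if "j \<in> {1..n}" "j \<noteq> i" for j
    using nonneg that i \<beta>_R_\<alpha> by (metis order_antisym)
  have eq: "\<theta> = (\<beta> i \<bullet> \<theta>) *\<^sub>R \<alpha> i"
  proof -
    have "\<theta> = (\<Sum>j=1..n. (\<beta> j \<bullet> \<theta>) *\<^sub>R \<alpha> j)"
      by (rule \<alpha>_expansion)
    also have "\<dots> = (\<Sum>j\<in>{i}. (\<beta> j \<bullet> \<theta>) *\<^sub>R \<alpha> j)"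
      using i zero by (intro sum.mono_neutral_right) auto
    finally show ?thesis
      by simp
  qed
  then have "\<bar>\<beta> i \<bullet> \<theta>\<bar> = 1"
    using root_norm[OF \<theta>] root_norm[OF \<alpha>_root[OF i]]
    by (metis mult.right_neutral norm_scaleR)
  then show ?thesis
    using eq nonneg i by (metis abs_of_nonneg scaleR_one)
qed

section \<open>Generation by simple reflections, and strong exchange\<close>

lemma S_subset_W: "S \<subseteq> W"
  using R_root_mem \<alpha>_root by (auto simp: S_def)

lemma S_word_in_W: "set fs \<subseteq> S \<Longrightarrow> compose_list fs \<in> W"
  using S_subset_W W_compose_list by blast

text \<open>The induction counts the roots of smaller height, since heights themselves are real.
  Reflecting in a simple root with positive inner product lowers the height and keeps the root
  positive, unless \<open>\<theta>\<close> is that simple root.\<close>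

lemma R_root_S_word_pos:
  assumes "\<theta> \<in> roots W" "v0 \<bullet> \<theta> > 0"
  shows "\<exists>fs. set fs \<subseteq> S \<and> R \<theta> = compose_list fs"
  using assms
proof (induction "card {\<phi> \<in> roots W. v0 \<bullet> \<phi> < v0 \<bullet> \<theta>}" arbitrary: \<theta> rule: less_induct)
  case less
  have nonneg: "\<forall>j\<in>{1..n}. \<beta> j \<bullet> \<theta> \<ge> 0"
    using less.prems by (simp add: v0_root_pos_iff)
  \<comment> \<open>Expanding one factor of \<open>\<theta> \<bullet> \<theta> > 0\<close> in the
    simple basis shows that some summand is positive.\<close>
  have "\<theta> \<bullet> \<theta> = \<theta> \<bullet> (\<Sum>j=1..n. (\<beta> j \<bullet> \<theta>) *\<^sub>R \<alpha> j)"
    by (rule arg_cong[OF \<alpha>_expansion])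
  then have "(\<Sum>j=1..n. (\<beta> j \<bullet> \<theta>) * (\<theta> \<bullet> \<alpha> j)) > 0"
    using root_nonzero[OF less.prems(1)] unfolding inner_sum_right
    by (metis (no_types, lifting) inner_gt_zero_iff inner_scaleR_right sum.cong)
  then obtain i where i: "i \<in> {1..n}" "(\<beta> i \<bullet> \<theta>) * (\<theta> \<bullet> \<alpha> i) > 0"
    by (meson sum_nonpos not_le)
  then have \<theta>\<alpha>: "\<theta> \<bullet> \<alpha> i > 0"
    using nonneg by (metis zero_less_mult_iff not_le)
  show ?case
  proof (cases "\<theta> = \<alpha> i")
    case True
    then show ?thesis
      using i(1) by (intro exI[of _ "[R \<theta>]"]) (auto simp: S_def)
  next
    case False
    let ?\<psi> = "R (\<alpha> i) \<theta>"
    have \<alpha>W: "R (\<alpha> i) \<in> W"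
      using i(1) by (simp add: R_root_mem \<alpha>_root)
    then have \<psi>: "?\<psi> \<in> roots W"
      using less.prems by (simp add: root_image)
    have \<psi>_pos: "v0 \<bullet> ?\<psi> > 0"
      using simple_reflection_makes_negative[OF i(1) less.prems] False v0_root_nonzero[OF \<psi>]
      by force
    have "v0 \<bullet> \<alpha> i > 0"
      using i(1) by (intro v0_inner_pos) (auto simp: dual root_nonzero[OF \<alpha>_root])
    then have less: "v0 \<bullet> ?\<psi> < v0 \<bullet> \<theta>"
      using \<theta>\<alpha> by (simp add: R_unit[OF root_norm[OF \<alpha>_root[OF i(1)]]] inner_diff_right inner_commute)
    then have "{\<phi> \<in> roots W. v0 \<bullet> \<phi> < v0 \<bullet> ?\<psi>} \<subset> {\<phi> \<in> roots W. v0 \<bullet> \<phi> < v0 \<bullet> \<theta>}"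
      using \<psi> by force
    then have "card {\<phi> \<in> roots W. v0 \<bullet> \<phi> < v0 \<bullet> ?\<psi>} < card {\<phi> \<in> roots W. v0 \<bullet> \<phi> < v0 \<bullet> \<theta>}"
      by (intro psubset_card_mono) (simp_all add: finite_roots)
    then obtain fs where fs: "set fs \<subseteq> S" "R ?\<psi> = compose_list fs"
      using less.hyps \<psi> \<psi>_pos by blast
    \<comment> \<open>Conjugation by the simple reflection turns the word for
      \<open>R ?\<psi>\<close> into one for \<open>R \<theta>\<close>.\<close>
    have "R \<theta> = R (\<alpha> i) \<circ> compose_list fs \<circ> R (\<alpha> i)"
      using R_image[OF \<alpha>W, of \<theta>] fs(2) by (simp add: fun_eq_iff R_R)
    then have "R \<theta> = compose_list (R (\<alpha> i) # fs @ [R (\<alpha> i)])"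
      by (simp add: compose_list_append comp_assoc)
    moreover have "set (R (\<alpha> i) # fs @ [R (\<alpha> i)]) \<subseteq> S"
      using fs i(1) by (auto simp: S_def)
    ultimately show ?thesis
      by blast
  qed
qed

lemma R_root_S_word:
  assumes "\<theta> \<in> roots W"
  shows "\<exists>fs. set fs \<subseteq> S \<and> R \<theta> = compose_list fs"
proof (cases "v0 \<bullet> \<theta> > 0")
  case False
  then show ?thesis
    using R_root_S_word_pos[of "- \<theta>"] v0_root_nonzero[OF assms] root_minus[OF assms]
    by (simp add: R_minus)
qed (simp add: R_root_S_word_pos assms)

lemma W_S_word:
  assumes "w \<in> W"
  obtains fs where "set fs \<subseteq> S" "w = compose_list fs"
proof -
  obtain ts where "set ts \<subseteq> reflections W" "w = compose_list ts"
    using W_word assms by blast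
  moreover have "\<exists>fs. set fs \<subseteq> S \<and> compose_list ts = compose_list fs"
    if "set ts \<subseteq> reflections W" for ts
    using that
  proof (induction ts)
    case (Cons t ts)
    obtain fs where "set fs \<subseteq> S" "compose_list ts = compose_list fs"
      using Cons by auto
    moreover obtain gs where "set gs \<subseteq> S" "t = compose_list gs"
      using Cons.prems R_root_S_word reflections_root by (metis list.set_intros(1) subsetD)
    ultimately show ?case
      by (intro exI[of _ "gs @ fs"]) (simp add: compose_list_append)
  qed (auto intro: exI[of _ "[]"])
  ultimately show thesis
    using that by blast
qed

text \<open>Follow \<open>\<theta>\<close> through the suffixes of the word. At a letter where its
  image turns negative, that image was the simple root of the letter, and the letter cancels against
  \<open>R \<theta>\<close>.\<close>

lemma strong_exchange:
  assumes "set fs \<subseteq> S" and \<theta>: "\<theta> \<in> roots W" "v0 \<bullet> \<theta> > 0"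
    and "v0 \<bullet> compose_list fs \<theta> < 0"
  shows "\<exists>gs. set gs \<subseteq> S \<and> length gs < length fs \<and> compose_list fs \<circ> R \<theta> = compose_list gs"
  using assms(1,4)
proof (induction fs)
  case Nil
  then show ?case
    using \<theta> by simp
next
  case (Cons f fs)
  let ?g = "compose_list fs"
  have gW: "?g \<in> W"
    using Cons.prems by (simp add: S_word_in_W)
  then have root: "?g \<theta> \<in> roots W"
    using \<theta> by (simp add: root_image)
  show ?case
  proof (cases "v0 \<bullet> ?g \<theta> < 0")
    case True
    then obtain gs where "set gs \<subseteq> S" "length gs < length fs" "?g \<circ> R \<theta> = compose_list gs"
      using Cons.IH Cons.prems(1) by (metis True insert_subset list.simps(15))
    then show ?thesis
      using Cons.prems by (intro exI[of _ "f # gs"]) (simp add: comp_assoc del: comp_apply)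
  next
    case False
    obtain i where i: "i \<in> {1..n}" "f = R (\<alpha> i)"
      using Cons.prems by (auto simp: S_def)
    \<comment> \<open>The sign changes at the letter \<open>f\<close>, so \<open>f\<close> is
      \<open>R (?g \<theta>)\<close>. Moving it past \<open>?g\<close> turns it into
      \<open>R \<theta>\<close>, and the two copies cancel.\<close>
    have "?g \<theta> = \<alpha> i"
      using simple_reflection_makes_negative[OF i(1) root] False v0_root_nonzero[OF root] Cons.prems i
      by force
    then have "compose_list (f # fs) \<circ> R \<theta> = R (?g \<theta>) \<circ> (?g \<circ> R \<theta>)"
      using i by (simp add: comp_assoc)
    also have "\<dots> = ?g \<circ> (R \<theta> \<circ> R \<theta>)"
      using R_image[OF gW, of \<theta>] by (simp add: comp_assoc[symmetric])
    finally show ?thesis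
      using Cons.prems by (intro exI[of _ fs]) (simp add: R_comp_R del: comp_apply)
  qed
qed

lemma word_length_S_R_less:
  assumes w: "w \<in> W" and \<theta>: "\<theta> \<in> roots W" "v0 \<bullet> \<theta> > 0" and neg: "v0 \<bullet> w \<theta> < 0"
  shows "word_length S (w \<circ> R \<theta>) < word_length S w"
proof -
  obtain fs where "set fs \<subseteq> S" "length fs = word_length S w" "w = compose_list fs"
    using W_S_word[OF w] word_length_attained by metis
  then show ?thesis
    using strong_exchange[OF _ \<theta>, of fs] neg word_length_le by (metis le_less_trans)
qed

text \<open>If \<open>w \<theta>\<close> is positive, then \<open>w \<circ> R \<theta>\<close> sends
  \<open>\<theta>\<close> to a negative root, so \<open>word_length_S_R_less\<close> applies to it
  and compares it with \<open>w\<close>.\<close>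

lemma word_length_S_R_greater_iff:
  assumes w: "w \<in> W" and \<theta>: "\<theta> \<in> roots W" "v0 \<bullet> \<theta> > 0"
  shows "word_length S w < word_length S (w \<circ> R \<theta>) \<longleftrightarrow> v0 \<bullet> w \<theta> > 0"
proof (cases "v0 \<bullet> w \<theta> > 0")
  case True
  have "(w \<circ> R \<theta>) \<theta> = - w \<theta>"
    using W_linear[OF w] by (simp add: R_self linear_neg)
  then have "word_length S ((w \<circ> R \<theta>) \<circ> R \<theta>) < word_length S (w \<circ> R \<theta>)"
    using True w \<theta> by (intro word_length_S_R_less) (simp_all add: W_comp R_root_mem)
  then show ?thesis
    using True by (simp add: comp_assoc R_comp_R)
next
  case False
  then have "v0 \<bullet> w \<theta> < 0"
    using v0_root_nonzero[OF root_image[OF w \<theta>(1)]] by linarith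
  then show ?thesis
    using word_length_S_R_less[OF w \<theta>] by simp
qed

end

section \<open>Reflection factorisations of the Coxeter element\<close>

declare upt_Suc [simp del]

text \<open>The factors are numbered from 1, so index 0 is the empty product and serves as the start
  of the chain.\<close>

definition partial_product :: "(nat \<Rightarrow> 'a::euclidean_space) \<Rightarrow> nat \<Rightarrow> 'a \<Rightarrow> 'a" where
  "partial_product \<theta> j = compose_list (map (\<lambda>i. R (\<theta> i)) [1..<Suc j])"

lemma partial_product_0: "partial_product \<theta> 0 = id"
  by (simp add: partial_product_def)

lemma partial_product_Suc: "partial_product \<theta> (Suc j) = partial_product \<theta> j \<circ> R (\<theta> (Suc j))"
  by (simp add: partial_product_def upt_Suc compose_list_append)

lemma partial_product_append:
  assumes "i \<le> j"
  shows "partial_product \<theta> i \<circ> compose_list (map (\<lambda>i. R (\<theta> i)) [Suc i..<Suc j])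
    = partial_product \<theta> j"
proof -
  have "[1..<Suc j] = [1..<Suc i] @ [Suc i..<Suc j]"
    using assms upt_add_eq_append[of 1 "Suc i" "j - i"] by simp
  then show ?thesis
    by (simp only: partial_product_def map_append compose_list_append)
qed

context reflection_group
begin

lemma W_inv_comp_R:
  assumes "w \<in> W" "\<theta> \<in> roots W"
  shows "inv (w \<circ> R \<theta>) x = R \<theta> (inv w x)"
proof -
  have "w \<circ> R \<theta> \<in> W"
    using assms by (simp add: W_comp R_root_mem)
  moreover have "(w \<circ> R \<theta>) (R \<theta> (inv w x)) = x"
    using assms by (simp add: R_R W_inv_right)
  ultimately show ?thesis
    by (metis W_inv_left)
qed

lemma W_inv_comp_left: "w \<in> W \<Longrightarrow> inv w \<circ> (w \<circ> f) = f"
  by (simp add: fun_eq_iff W_inv_left)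

lemma R_roots_word:
  assumes "\<And>j. j \<in> J \<Longrightarrow> \<theta> j \<in> roots W" "set js \<subseteq> J"
  shows "set (map (\<lambda>i. R (\<theta> i)) js) \<subseteq> reflections W"
  using assms R_root_reflections by auto

lemma word_length_reflections_0:
  assumes "w \<in> W" "word_length (reflections W) w = 0"
  shows "w = id"
proof -
  obtain ts where "set ts \<subseteq> reflections W" "w = compose_list ts"
    using W_word assms(1) by blast
  then obtain us where "length us = 0" "compose_list us = w"
    using word_length_attained assms(2) by metis
  then show ?thesis
    by simp
qed

lemma word_length_reflections_triangle:
  assumes "v \<in> W" "w \<in> W"
  shows "word_length (reflections W) (v \<circ> w)
    \<le> word_length (reflections W) v + word_length (reflections W) w"
  using W_word[OF assms(1)] W_word[OF assms(2)] word_length_comp_le by blast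

text \<open>Along \<open>u\<close>, \<open>z\<close>, \<open>w\<close> the lengths of the two
  quotients add up to 1. One of them is 0, and that quotient is the identity.\<close>

lemma covered_T_if_word_length_1:
  assumes le: "le_T W u w" and 1: "word_length (reflections W) (inv u \<circ> w) = 1"
  shows "covered_T W u w"
proof -
  let ?l = "word_length (reflections W)"
  have uw: "u \<in> W" "w \<in> W" "?l w = ?l u + 1"
    using le 1 by (auto simp: le_T_def)
  have eq: "v = z" if "v \<in> W" "z \<in> W" "?l (inv v \<circ> z) = 0" for v z
  proof -
    have "inv v \<circ> z = id"
      using that by (intro word_length_reflections_0 W_comp W_inv)
    then show ?thesis
      using that(1) by (metis W_inv_right comp_apply id_apply ext)
  qed
  have "z = u \<or> z = w" if "le_T W u z" "le_T W z w" for z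
  proof -
    have "z \<in> W" "?l (inv u \<circ> z) + ?l (inv z \<circ> w) = 1"
      using that uw by (auto simp: le_T_def)
    then show ?thesis
      using eq[of u z] eq[of z w] uw by (auto simp: add_is_1)
  qed
  then show ?thesis
    using le uw by (auto simp: covered_T_def)
qed

lemma partial_product_mem:
  assumes "\<And>i. i \<in> {1..j} \<Longrightarrow> \<theta> i \<in> roots W"
  shows "partial_product \<theta> j \<in> W"
  unfolding partial_product_def
  using assms by (intro compose_reflections_mem R_roots_word[of "{1..j}"]) auto

text \<open>Passing to the next partial product applies one more reflection to the inverse image of
  \<open>v\<close>, so \<open>R_chain_expansion\<close> applies. Orthogonality of the group then
  moves the inverse across the inner product.\<close>

lemma inv_partial_product_expansion:
  assumes w: "w \<in> W" and \<theta>: "\<And>j. j \<in> {1..n} \<Longrightarrow> \<theta> j \<in> roots W"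
  shows "inv (w \<circ> partial_product \<theta> n) v
    = inv w v - 2 *\<^sub>R (\<Sum>j=1..n. (v \<bullet> (w \<circ> partial_product \<theta> (j - 1)) (\<theta> j)) *\<^sub>R \<theta> j)"
proof -
  define u where "u j = w \<circ> partial_product \<theta> j" for j
  have uW: "u j \<in> W" if "j \<le> n" for j
    using that w \<theta> unfolding u_def by (intro W_comp partial_product_mem) auto
  have "inv (u (Suc j)) v = R (\<theta> (Suc j)) (inv (u j) v)" if "j < n" for j
  proof -
    have "u (Suc j) = u j \<circ> R (\<theta> (Suc j))"
      by (simp add: u_def partial_product_Suc comp_assoc)
    then show ?thesis
      using that uW \<theta> by (simp add: W_inv_comp_R)
  qed
  then have "inv (u n) v
      = inv (u 0) v - 2 *\<^sub>R (\<Sum>j=1..n. (\<theta> j \<bullet> inv (u (j - 1)) v) *\<^sub>R \<theta> j)"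
    using \<theta> by (intro R_chain_expansion[where y = "\<lambda>j. inv (u j) v"]) (simp_all add: root_norm)
  moreover have "(\<Sum>j=1..n. (\<theta> j \<bullet> inv (u (j - 1)) v) *\<^sub>R \<theta> j)
      = (\<Sum>j=1..n. (v \<bullet> u (j - 1) (\<theta> j)) *\<^sub>R \<theta> j)"
  proof (intro sum.cong refl)
    fix j
    assume "j \<in> {1..n}"
    then have "u (j - 1) \<in> W"
      by (intro uW) auto
    then show "(\<theta> j \<bullet> inv (u (j - 1)) v) *\<^sub>R \<theta> j = (v \<bullet> u (j - 1) (\<theta> j)) *\<^sub>R \<theta> j"
      using inner_W_inv by (metis inner_commute)
  qed
  ultimately show ?thesis
    by (simp add: u_def partial_product_0)
qed

end

text \<open>Without fixed vectors \<open>c - I\<close> is injective, hence bijective, so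
  \<open>inv\<close> in \<open>mu\<close> is a true inverse. It commutes with \<open>c\<close>
  because \<open>c - I\<close> does.\<close>

lemma mu_linear:
  assumes c: "linear c" and no_fixed: "\<And>v. c v = v \<Longrightarrow> v = (0::'a::euclidean_space)"
  shows "linear (mu c)" "mu c (c x - x) = - 2 *\<^sub>R x" "mu c (c v) = c (mu c v)"
proof -
  let ?f = "\<lambda>x. c x - x"
  have lin: "linear ?f"
    using c by (intro linear_compose_sub) (auto simp: linear_id[unfolded id_def])
  have inj: "inj ?f"
    using no_fixed by (simp add: linear_injective_0[OF lin])
  show "linear (mu c)"
  proof -
    have "linear (inv ?f)"
      using lin inj by (metis inj_linear_imp_inv_linear)
    then show ?thesis
      unfolding mu_def by (intro linear_compose_scale_right)
  qed
  show *: "mu c (c x - x) = - 2 *\<^sub>R x" for x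
    using inv_f_f[OF inj, of x] by (simp add: mu_def)
  have "surj ?f"
    using lin inj by (simp add: linear_injective_imp_surjective)
  then obtain y where v: "v = c y - y"
    by (meson surjD)
  have "c v = c (c y) - c y"
    using v by (simp add: linear_diff[OF c])
  then show "mu c (c v) = c (mu c v)"
    using *[of y] *[of "c y"] v by (simp add: linear_scale[OF c] linear_neg[OF c])
qed

section \<open>Fixed vectors and reflection length of the Coxeter element\<close>

context simple_system
begin

lemma c_eq: "c = partial_product \<alpha> n"
  by (simp add: c_def coxeter_element_def partial_product_def)

lemma c_mem: "c \<in> W"
  unfolding c_eq by (intro partial_product_mem \<alpha>_root)

text \<open>For a fixed \<open>v\<close> the expansion becomes a linear relation among the simple
  roots, so every \<open>a j\<close> is 0. Then each inverse partial product fixes \<open>v\<close>,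
  hence \<open>a j\<close> is \<open>v \<bullet> \<alpha> j\<close>, and \<open>v\<close> is
  orthogonal to a basis.\<close>

lemma c_no_fixed_vector:
  assumes "c v = v"
  shows "v = 0"
proof -
  let ?P = "partial_product \<alpha>"
  define a where "a j = v \<bullet> ?P (j - 1) (\<alpha> j)" for j
  have mem: "?P j \<in> W" if "j \<le> n" for j
    using that by (intro partial_product_mem \<alpha>_root) auto
  have expansion: "inv (?P j) v = v - 2 *\<^sub>R (\<Sum>i=1..j. a i *\<^sub>R \<alpha> i)" if "j \<le> n" for j
    using inv_partial_product_expansion[OF W_id, of j \<alpha> v] \<alpha>_root that by (simp add: a_def)
  have "inv c v = v"
    using assms c_mem W_inv_left by metis
  then have "(\<Sum>j=1..n. a j *\<^sub>R \<alpha> j) = 0"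
    using expansion[of n] by (simp add: c_eq)
  then have zero: "a j = 0" if "j \<in> {1..n}" for j
    using \<beta>_sum_\<alpha>[OF that, of a] by simp
  have inv_fixed: "inv (?P j) v = v" if "j \<le> n" for j
  proof -
    have "(\<Sum>i=1..j. a i *\<^sub>R \<alpha> i) = 0"
      using zero that by (intro sum.neutral) auto
    then show ?thesis
      using expansion[OF that] by simp
  qed
  have "\<alpha> j \<bullet> v = 0" if "j \<in> {1..n}" for j
  proof -
    have "j - 1 \<le> n"
      using that by auto
    then show ?thesis
      using zero[OF that] inner_W_inv[OF mem, of "j - 1" v "\<alpha> j"] inv_fixed[of "j - 1"]
      by (metis a_def inner_commute)
  qed
  then have "v \<bullet> v = 0"
    using arg_cong[OF \<alpha>_expansion[of v], of "\<lambda>x. x \<bullet> v"] by (simp add: inner_sum_left)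
  then show ?thesis
    by simp
qed

text \<open>A vector orthogonal to all the \<open>\<theta>s\<close> is fixed by the product, hence
  zero.\<close>

lemma c_word_spans:
  assumes "c = compose_list (map R \<theta>s)"
  shows "span (set \<theta>s) = UNIV"
proof (rule span_eq_UNIV_if_orthogonal_zero)
  fix x
  assume "\<forall>\<theta>\<in>set \<theta>s. \<theta> \<bullet> x = 0"
  then show "x = 0"
    using compose_list_R_fixes_orthogonal[of \<theta>s x] assms by (intro c_no_fixed_vector) simp
qed

text \<open>The vectors of any reflection word for \<open>c\<close> span the space, so there are at
  least \<open>n\<close> of them; the defining word attains this bound.\<close>

lemma word_length_reflections_c: "word_length (reflections W) c = n"
proof -
  have word: "set (map (\<lambda>i. R (\<alpha> i)) [1..<Suc n]) \<subseteq> reflections W"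
    by (intro R_roots_word[of "{1..n}"]) (auto intro: \<alpha>_root)
  then have "word_length (reflections W) c \<le> n"
    using word_length_le[OF word] by (simp add: c_eq partial_product_def)
  moreover obtain ts where ts: "set ts \<subseteq> reflections W"
    "length ts = word_length (reflections W) c" "compose_list ts = c"
    using word_length_attained[OF word] by (metis c_eq partial_product_def)
  have "\<exists>\<theta>s. ts = map R \<theta>s"
    using ts(1) by (metis ex_map_conv reflections_root subsetD)
  then obtain \<theta>s where \<theta>s: "ts = map R \<theta>s"
    by blast
  then have "span (set \<theta>s) = UNIV"
    using c_word_spans ts(3) by simp
  then have "n \<le> card (set \<theta>s)"
    using n by (metis dim_UNIV dim_le_card dim_span finite_set order_refl)
  then have "n \<le> length ts"
    using card_length[of \<theta>s] \<theta>s by simp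
  ultimately show ?thesis
    using ts(2) by simp
qed

section \<open>A given factorisation of the Coxeter element into reflections\<close>

context
  fixes \<theta> :: "nat \<Rightarrow> 'a"
  assumes \<theta>_root: "\<And>j. j \<in> {1..n} \<Longrightarrow> \<theta> j \<in> roots W"
    and c_factorisation: "c = partial_product \<theta> n"
begin

lemma partial_product_n: "partial_product \<theta> n = c"
  by (simp add: c_factorisation)

lemma factor_product_mem: "j \<le> n \<Longrightarrow> partial_product \<theta> j \<in> W"
  by (intro partial_product_mem \<theta>_root) auto

lemma partial_product_quotient_length_le:
  assumes "i \<le> j" "j \<le> n"
  shows "word_length (reflections W) (inv (partial_product \<theta> i) \<circ> partial_product \<theta> j) \<le> j - i"
proof -
  let ?js = "[Suc i..<Suc j]"
  have "partial_product \<theta> i \<circ> compose_list (map (\<lambda>i. R (\<theta> i)) ?js) = partial_product \<theta> j"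
    using assms(1) by (rule partial_product_append)
  then have "inv (partial_product \<theta> i) \<circ> partial_product \<theta> j = compose_list (map (\<lambda>i. R (\<theta> i)) ?js)"
    using assms factor_product_mem[of i] W_inv_comp_left by (metis le_trans)
  moreover have "set (map (\<lambda>i. R (\<theta> i)) ?js) \<subseteq> reflections W"
    using assms by (intro R_roots_word[of "{1..n}"]) (auto intro: \<theta>_root)
  ultimately show ?thesis
    using word_length_le[of "map (\<lambda>i. R (\<theta> i)) ?js"] by simp
qed

text \<open>The blocks up to \<open>i\<close>, from \<open>i\<close> to \<open>j\<close>, and from
  \<open>j\<close> to \<open>n\<close> have lengths at most \<open>i\<close>, \<open>j - i\<close>
  and \<open>n - j\<close>. Since \<open>c\<close> has length \<open>n\<close>, the triangle
  inequality forces equality in each.\<close>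

lemma partial_product_quotient_length:
  assumes ij: "i \<le> j" "j \<le> n"
  shows "word_length (reflections W) (inv (partial_product \<theta> i) \<circ> partial_product \<theta> j) = j - i"
proof -
  let ?l = "word_length (reflections W)" and ?q = "\<lambda>i j. inv (partial_product \<theta> i) \<circ> partial_product \<theta> j"
  have tri: "?l (?q h k) \<le> ?l (?q h i) + ?l (?q i k)" if "h \<le> n" "i \<le> n" "k \<le> n" for h i k
  proof -
    have "?q h k = ?q h i \<circ> ?q i k"
      using that factor_product_mem by (simp add: fun_eq_iff W_inv_right)
    then show ?thesis
      using that factor_product_mem word_length_reflections_triangle by (metis W_comp W_inv)
  qed
  have "?l (?q 0 n) = n"
    by (simp add: partial_product_0 partial_product_n word_length_reflections_c)
  then have "n \<le> ?l (?q 0 i) + (?l (?q i j) + ?l (?q j n))"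
    using tri[of 0 i n] tri[of i j n] ij by linarith
  then show ?thesis
    using partial_product_quotient_length_le[of 0 i] partial_product_quotient_length_le[of i j]
      partial_product_quotient_length_le[of j n] ij by linarith
qed

lemma partial_product_length: "j \<le> n \<Longrightarrow> word_length (reflections W) (partial_product \<theta> j) = j"
  using partial_product_quotient_length[of 0 j] by (simp add: partial_product_0)

lemma partial_product_le_T: "i \<le> j \<Longrightarrow> j \<le> n \<Longrightarrow> le_T W (partial_product \<theta> i) (partial_product \<theta> j)"
  by (simp add: le_T_def factor_product_mem partial_product_length partial_product_quotient_length)

text \<open>Successive partial products have quotients of reflection length 1, so they form a chain
  of covers up to \<open>c\<close>; what remains is the condition on lengths with respect to
  \<open>S\<close>.\<close>

lemma special_simplex_iff:
  assumes w0: "w0 \<in> W" and w: "\<And>j. j \<le> n \<Longrightarrow> w j = w0 \<circ> partial_product \<theta> j"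
  shows "special_simplex W n \<alpha> w \<longleftrightarrow>
    (\<forall>i\<in>{1..n}. word_length S (w i) = word_length S (w 0) + i)"
proof -
  have w_0: "w 0 = w0"
    using w[of 0] by (simp add: partial_product_0)
  have quot: "inv (w 0) \<circ> w i = partial_product \<theta> i" if "i \<le> n" for i
    using w[OF that] w_0 w0 by (simp add: W_inv_comp_left)
  have "w i \<in> W" if "i \<le> n" for i
    using w[OF that] w0 factor_product_mem[OF that] by (simp add: W_comp)
  moreover have "inv (w 0) \<circ> w i \<in> noncrossing_partitions W c" if "i \<le> n" for i
    using that factor_product_mem partial_product_le_T[of i n] by (simp add: quot noncrossing_partitions_def partial_product_n)
  moreover have "covered_T W (inv (w 0) \<circ> w i) (inv (w 0) \<circ> w (Suc i))" if "i < n" for i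
    using that partial_product_le_T[of i "Suc i"] partial_product_quotient_length[of i "Suc i"]
    by (simp add: quot covered_T_if_word_length_1)
  moreover have "inv (w 0) \<circ> w n = c"
    by (simp add: quot partial_product_n)
  ultimately show ?thesis
    unfolding special_simplex_def Let_def c_def[symmetric] S_def[symmetric] by blast
qed

text \<open>For \<open>\<longleftarrow>\<close>, each step lengthens the word by at least one, while \<open>c\<close> itself has length at most
  \<open>n\<close>, so no step can gain more.\<close>

lemma word_length_S_chain_iff:
  assumes w0: "w0 \<in> W" and \<theta>_pos: "\<And>j. j \<in> {1..n} \<Longrightarrow> v0 \<bullet> \<theta> j > 0"
  shows "(\<forall>i\<in>{1..n}. word_length S (w0 \<circ> partial_product \<theta> i) = word_length S w0 + i) \<longleftrightarrow>
    (\<forall>j\<in>{1..n}. v0 \<bullet> (w0 \<circ> partial_product \<theta> (j - 1)) (\<theta> j) > 0)"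
    (is "?L \<longleftrightarrow> ?R")
proof -
  define f where "f j = word_length S (w0 \<circ> partial_product \<theta> j)" for j
  have f0: "f 0 = word_length S w0"
    by (simp add: f_def partial_product_0)
  have step: "f j < f (Suc j) \<longleftrightarrow> v0 \<bullet> (w0 \<circ> partial_product \<theta> j) (\<theta> (Suc j)) > 0" if "j < n" for j
    using word_length_S_R_greater_iff[of "w0 \<circ> partial_product \<theta> j" "\<theta> (Suc j)"] that w0
      factor_product_mem[of j] \<theta>_root[of "Suc j"] \<theta>_pos[of "Suc j"]
    by (simp add: f_def partial_product_Suc W_comp comp_assoc)
  have R: "?R \<longleftrightarrow> (\<forall>j<n. f j < f (Suc j))"
  proof
    assume ?R
    then show "\<forall>j<n. f j < f (Suc j)"
      using step by force
  next
    assume *: "\<forall>j<n. f j < f (Suc j)"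
    show ?R
    proof
      fix j
      assume "j \<in> {1..n}"
      then show "v0 \<bullet> (w0 \<circ> partial_product \<theta> (j - 1)) (\<theta> j) > 0"
        using step[of "j - 1"] *[rule_format, of "j - 1"] by auto
    qed
  qed
  \<comment> \<open>Here \<open>c\<close> is written in the \<open>n\<close> simple reflections
    instead of the reflections in the \<open>\<theta> j\<close>.\<close>
  have fn: "f n \<le> f 0 + n"
  proof -
    obtain fs where fs: "set fs \<subseteq> S" "w0 = compose_list fs"
      using W_S_word[OF w0] .
    let ?as = "map (\<lambda>i. R (\<alpha> i)) [1..<Suc n]"
    have as: "set ?as \<subseteq> S"
      by (auto simp: S_def)
    then have "word_length S c \<le> n"
      using word_length_le[OF as] by (simp add: c_eq partial_product_def)
    then show ?thesis
      using word_length_comp_le[OF fs(1) as] fs(2) f0 by (simp add: f_def partial_product_n)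
        (simp add: c_eq partial_product_def)
  qed
  show ?thesis
  proof
    assume L: ?L
    have eq: "f i = f 0 + i" if "i \<le> n" for i
      using L f0 that by (cases "i = 0") (auto simp: f_def)
    have "f j < f (Suc j)" if "j < n" for j
      using eq[of j] eq[of "Suc j"] that by linarith
    then show ?R
      unfolding R by blast
  next
    assume ?R
    then have inc: "f j < f (Suc j)" if "j < n" for j
      using that R by blast
    \<comment> \<open>Used from 0 to \<open>i\<close> and from \<open>i\<close> to \<open>n\<close>,
      this bounds \<open>f i\<close> from below and, together with \<open>fn\<close>, from
      above.\<close>
    have gap: "f i + k \<le> f (i + k)" if "i + k \<le> n" for i k
      using that
    proof (induction k)
      case (Suc k)
      then show ?case
        using inc[of "i + k"] by simp
    qed simp
    have "f i = f 0 + i" if "i \<le> n" for i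
      using gap[of 0 i] gap[of i "n - i"] fn that by simp
    then show ?L
      using f0 unfolding f_def by (metis atLeastAtMost_iff)
  qed
qed

text \<open>Both vectors are images of the single combination with coefficients \<open>a j\<close>
  of the \<open>\<theta> j\<close>, under \<open>- mu c\<close> and under its composite with
  \<open>c\<close>. Both maps are invertible, so each cone condition reads off the signs of the same
  coefficients.\<close>

lemma mu_cone_iffs:
  assumes w0: "w0 \<in> W"
  defines "a \<equiv> \<lambda>j. v0 \<bullet> (w0 \<circ> partial_product \<theta> (j - 1)) (\<theta> j)"
  shows "inv (w0 \<circ> c) v0 \<in> nonneg_cone ((\<lambda>j. - mu c (\<theta> j)) ` {1..n})
      \<longleftrightarrow> (\<forall>j\<in>{1..n}. a j \<ge> 0)" (is "?C \<longleftrightarrow> ?a")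
    and "inv w0 v0 \<in> nonneg_cone ((\<lambda>j. - mu c (c (\<theta> j))) ` {1..n})
      \<longleftrightarrow> (\<forall>j\<in>{1..n}. a j \<ge> 0)" (is "?B \<longleftrightarrow> ?a")
proof -
  note c_linear = W_linear[OF c_mem]
  have mu: "linear (mu c)" "mu c (c x - x) = - 2 *\<^sub>R x" "mu c (c x) = c (mu c x)" for x
    by (rule mu_linear[OF c_linear], erule c_no_fixed_vector)+
  let ?y = "inv (w0 \<circ> c) v0"
  have cy: "c ?y = inv w0 v0"
  proof -
    have "w0 (c ?y) = v0"
      using W_inv_right[OF W_comp[OF w0 c_mem], of v0] by simp
    then show ?thesis
      using W_inv_left[OF w0, of "c ?y"] by simp
  qed
  have "?y = inv w0 v0 - 2 *\<^sub>R (\<Sum>j=1..n. a j *\<^sub>R \<theta> j)"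
    using inv_partial_product_expansion[OF w0, of n \<theta> v0] \<theta>_root partial_product_n
    by (simp add: a_def)
  \<comment> \<open>The expansion computes \<open>c - I\<close> at \<open>?y\<close>, which is just
    what \<open>mu c\<close> inverts up to the factor -2.\<close>
  then have "c ?y - ?y = 2 *\<^sub>R (\<Sum>j=1..n. a j *\<^sub>R \<theta> j)"
    unfolding cy by (simp only: diff_diff_eq2 add_diff_cancel_left')
  then have "mu c (2 *\<^sub>R (\<Sum>j=1..n. a j *\<^sub>R \<theta> j)) = 2 *\<^sub>R (- ?y)"
    using mu(2)[of ?y] by simp
  then have "2 *\<^sub>R mu c (\<Sum>j=1..n. a j *\<^sub>R \<theta> j) = 2 *\<^sub>R (- ?y)"
    by (simp only: linear_scale[OF mu(1)])
  then have "mu c (\<Sum>j=1..n. a j *\<^sub>R \<theta> j) = - ?y"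
    by (rule scaleR_left_imp_eq[rotated]) simp
  then have y: "?y = - mu c (\<Sum>j=1..n. a j *\<^sub>R \<theta> j)"
    by (simp only: minus_minus)
  have x: "inv w0 v0 = - mu c (c (\<Sum>j=1..n. a j *\<^sub>R \<theta> j))"
    unfolding cy[symmetric] y by (simp only: mu(3) linear_neg[OF c_linear])
  have span: "span (\<theta> ` {1..n}) = UNIV"
    using c_word_spans[of "map \<theta> [1..<Suc n]"] c_factorisation
    by (simp add: partial_product_def comp_def atLeastLessThanSuc_atLeastAtMost)
  \<comment> \<open>The \<open>n\<close> vectors \<open>\<theta> j\<close> span, and so do their
    images under a surjective linear map; being \<open>n\<close> in number, the images form a
    basis.\<close>
  have iff: "g (\<Sum>j=1..n. a j *\<^sub>R \<theta> j) \<in> nonneg_cone ((\<lambda>j. g (\<theta> j)) ` {1..n}) \<longleftrightarrow> ?a"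
    if g: "linear g" "surj g" for g :: "'a \<Rightarrow> 'a"
  proof -
    have "span ((\<lambda>j. g (\<theta> j)) ` {1..n}) = UNIV"
      using g span linear_span_image[OF g(1), of "\<theta> ` {1..n}"] by (simp add: image_image)
    then have "(\<Sum>j=1..n. a j *\<^sub>R g (\<theta> j)) \<in> nonneg_cone ((\<lambda>j. g (\<theta> j)) ` {1..n}) \<longleftrightarrow> ?a"
      using n by (intro nonneg_cone_image_independent spanning_image_atLeastAtMost) simp_all
    then show ?thesis
      by (simp only: linear_sum[OF g(1)] linear_scale[OF g(1)])
  qed
  let ?g = "\<lambda>v. - mu c v"
  have lin_g: "linear ?g"
    using mu(1) by (rule linear_compose_neg)
  have surj_g: "surj ?g"
  proof (rule surjI)
    \<comment> \<open>The preimage comes from the definition of \<open>mu\<close>: the map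
      \<open>- mu c\<close> is twice the inverse of \<open>c - I\<close>.\<close>
    show "?g ((1/2) *\<^sub>R (c x - x)) = x" for x
      using mu(2)[of x] linear_scale[OF mu(1)] by simp
  qed
  show "?C \<longleftrightarrow> ?a"
    using iff[OF lin_g surj_g] by (simp only: y)
  have "linear (?g \<circ> c)" "surj (?g \<circ> c)"
    using linear_compose[OF c_linear lin_g] comp_surj[OF bij_is_surj[OF W_bij[OF c_mem]] surj_g]
    by - (assumption+)
  then show "?B \<longleftrightarrow> ?a"
    using iff[of "?g \<circ> c"] by (simp only: x comp_def)
qed

end

end

section \<open>From the chamber to the simple system\<close>

text \<open>If \<open>\<alpha>\<^sub>i\<close> were not among the roots cutting out the closed chamber, then \<open>- \<beta>\<^sub>i\<close>
  would lie in it, but \<open>\<alpha>\<^sub>i\<close> is negative there.\<close>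

lemma (in reflection_group) simple_system_of_chamber:
  fixes n :: nat and \<alpha> \<beta> :: "nat \<Rightarrow> 'a"
  assumes C: "C \<in> chambers W" and n: "n = DIM('a)"
    and \<alpha>: "\<alpha> ` {1..n} = inward_unit_normals C"
    and dual: "\<And>i j. i \<in> {1..n} \<Longrightarrow> j \<in> {1..n} \<Longrightarrow> \<beta> i \<bullet> \<alpha> j = (if i = j then 1 else 0)"
  shows "simple_system W n \<alpha> \<beta>"
proof
  obtain G where G: "G \<subseteq> roots W" "G \<subseteq> \<alpha> ` {1..n}" "closure C = {x. \<forall>g\<in>G. g \<bullet> x \<ge> 0}"
    using closure_chamber_inward_normals[OF C] \<alpha> by metis
  have closure_nonneg: "a \<bullet> x \<ge> 0" if "\<forall>x\<in>C. a \<bullet> x > 0" "x \<in> closure C" for a x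
  proof -
    have "closure C \<subseteq> {x. a \<bullet> x \<ge> 0}"
      using that(1) by (intro closure_minimal closed_halfspace_ge) (auto intro: less_imp_le)
    then show ?thesis
      using that(2) by blast
  qed
  show "\<alpha> i \<in> roots W" if i: "i \<in> {1..n}" for i
  proof (rule ccontr)
    assume "\<alpha> i \<notin> roots W"
    then have "g \<bullet> - \<beta> i = 0" if "g \<in> G" for g
    proof -
      obtain j where j: "j \<in> {1..n}" "g = \<alpha> j"
        using \<open>g \<in> G\<close> G(2) by blast
      then have "j \<noteq> i"
        using \<open>g \<in> G\<close> G(1) \<open>\<alpha> i \<notin> roots W\<close> by blast
      then show ?thesis
        using j dual[OF i, of j] by (simp add: inner_commute)
    qed
    then have "- \<beta> i \<in> closure C"
      using G(3) by simp
    moreover have "\<forall>x\<in>C. \<alpha> i \<bullet> x > 0"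
      using \<alpha> i by (auto simp: inward_unit_normals_def)
    ultimately have "\<alpha> i \<bullet> - \<beta> i \<ge> 0"
      by (rule closure_nonneg[rotated])
    then show False
      using dual[OF i i] by (simp add: inner_commute)
  qed
  \<comment> \<open>Every wall normal in \<open>G\<close> is some \<open>\<alpha> j\<close>, whose
    pairing with \<open>\<beta> i\<close> is 0 or 1.\<close>
  have \<beta>: "\<beta> i \<in> closure C" if "i \<in> {1..n}" for i
    using G(2,3) dual[OF that] by (auto simp: inner_commute)
  show "(\<forall>i\<in>{1..n}. \<beta> i \<bullet> \<theta> \<ge> 0) \<or> (\<forall>i\<in>{1..n}. \<beta> i \<bullet> \<theta> \<le> 0)" if \<theta>: "\<theta> \<in> roots W" for \<theta>
    \<comment> \<open>A root has one sign on the chamber, hence weakly the same sign on its closure,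
      where all the \<open>\<beta> i\<close> lie.\<close>
    using chamber_root_sign[OF C \<theta>]
  proof
    assume "\<forall>x\<in>C. \<theta> \<bullet> x > 0"
    then have "\<forall>i\<in>{1..n}. \<theta> \<bullet> \<beta> i \<ge> 0"
      using closure_nonneg[of \<theta>] \<beta> by blast
    then show ?thesis
      by (simp add: inner_commute)
  next
    assume "\<forall>x\<in>C. \<theta> \<bullet> x < 0"
    then have "\<forall>i\<in>{1..n}. - \<theta> \<bullet> \<beta> i \<ge> 0"
      using closure_nonneg[of "- \<theta>"] \<beta> by simp
    then show ?thesis
      by (simp add: inner_commute)
  qed
qed (use n dual in auto)

theorem proposition3p6:
  fixes W :: "((real ^ 'n) \<Rightarrow> (real ^ 'n)) set"
    and C :: "(real ^ 'n) set"
    and n :: nat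
    and \<alpha> \<beta> \<theta> :: "nat \<Rightarrow> real ^ 'n"
    and v0 :: "real ^ 'n"
    and c :: "(real ^ 'n) \<Rightarrow> (real ^ 'n)"
    and w :: "nat \<Rightarrow> (real ^ 'n) \<Rightarrow> (real ^ 'n)"
  assumes n_def: "n = CARD('n)"
    and W: "finite_reflection_group W" "irreducible_action W" "essential_action W"
    and C: "C \<in> chambers W"
    and simple: "bij_betw \<alpha> {1..n} (inward_unit_normals C)"
    and ordering: "\<exists>k\<le>n. orthonormal (\<alpha> ` {1..k}) \<and> orthonormal (\<alpha> ` {Suc k..n})"
    and dual: "\<forall>i\<in>{1..n}. \<forall>j\<in>{1..n}. \<beta> i \<bullet> \<alpha> j = (if i = j then 1 else 0)"
    and v0_def: "v0 = (\<Sum>i=1..n. \<beta> i)"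
    and c_def: "c = coxeter_element n \<alpha>"
    and w0: "w 0 \<in> W"
    and \<theta>: "\<forall>j\<in>{1..n}. \<theta> j \<in> positive_roots W (\<alpha> ` {1..n})"
    and factorisation: "c = compose_list (map (\<lambda>i. R (\<theta> i)) [1..<Suc n])"
    and w_def: "\<forall>j\<in>{1..n}. w j = w 0 \<circ> compose_list (map (\<lambda>i. R (\<theta> i)) [1..<Suc j])"
  shows "(special_simplex W n \<alpha> w
            \<longleftrightarrow> inv (w 0) v0 \<in> nonneg_cone ((\<lambda>j. - mu c (c (\<theta> j))) ` {1..n}))
       \<and> (inv (w 0) v0 \<in> nonneg_cone ((\<lambda>j. - mu c (c (\<theta> j))) ` {1..n})
            \<longleftrightarrow> inv (w n) v0 \<in> nonneg_cone ((\<lambda>j. - mu c (\<theta> j)) ` {1..n}))"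
proof -
  interpret reflection_group W
    using W(1) by unfold_locales
  interpret simple_system W n \<alpha> \<beta>
    rewrites "simple_system.v0 n \<beta> = v0" and "simple_system.c n \<alpha> = c"
  proof -
    show ss: "simple_system W n \<alpha> \<beta>"
      using C n_def simple dual by (intro simple_system_of_chamber) (auto simp: bij_betw_def)
    show "simple_system.v0 n \<beta> = v0" "simple_system.c n \<alpha> = c"
      using simple_system.v0_def[OF ss] simple_system.c_def[OF ss] v0_def c_def by simp_all
  qed
  have \<theta>_root: "\<theta> j \<in> roots W" if "j \<in> {1..n}" for j
    using \<theta> that by (simp add: positive_roots_def)
  have \<theta>_pos: "v0 \<bullet> \<theta> j > 0" if "j \<in> {1..n}" for j
  proof -
    have "\<forall>i\<in>{1..n}. \<beta> i \<bullet> \<theta> j \<ge> 0"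
      using \<theta> that dual nonneg_cone_eq_dual[of n \<beta> \<alpha> "\<theta> j"] by (simp add: positive_roots_def)
    then show ?thesis
      using v0_root_pos_iff \<theta>_root that by blast
  qed
  let ?pr = "partial_product \<theta>"
  have c: "c = ?pr n"
    by (simp add: factorisation partial_product_def)
  \<comment> \<open>\<open>w_def\<close> starts at index 1; at index 0 the empty product supplies
    the identity.\<close>
  have w: "w j = w 0 \<circ> ?pr j" if "j \<le> n" for j
    using w_def that by (cases "j = 0") (simp_all add: partial_product_def)
  define a where "a j = v0 \<bullet> (w 0 \<circ> ?pr (j - 1)) (\<theta> j)" for j
  have special: "special_simplex W n \<alpha> w \<longleftrightarrow> (\<forall>j\<in>{1..n}. a j > 0)"
  proof -
    have "special_simplex W n \<alpha> w \<longleftrightarrow>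
        (\<forall>i\<in>{1..n}. word_length S (w i) = word_length S (w 0) + i)"
      by (rule special_simplex_iff[OF \<theta>_root c w0 w])
    also have "\<dots> \<longleftrightarrow>
        (\<forall>i\<in>{1..n}. word_length S (w 0 \<circ> ?pr i) = word_length S (w 0) + i)"
      using w by (intro ball_cong refl) (metis atLeastAtMost_iff)
    also have "\<dots> \<longleftrightarrow> (\<forall>j\<in>{1..n}. a j > 0)"
      unfolding a_def by (rule word_length_S_chain_iff[OF \<theta>_root c w0 \<theta>_pos])
    finally show ?thesis .
  qed
  \<comment> \<open>Lengths give \<open>a j > 0\<close> and cones give \<open>a j \<ge> 0\<close>.
    They agree because \<open>a j\<close> pairs \<open>v0\<close> with a root.\<close>
  have "a j \<noteq> 0" if "j \<in> {1..n}" for j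
  proof -
    have "j - 1 \<le> n"
      using that by auto
    then have mem: "w 0 \<circ> ?pr (j - 1) \<in> W"
      using w0 factor_product_mem[OF \<theta>_root c] by (simp add: W_comp)
    show ?thesis
      unfolding a_def by (rule v0_root_nonzero[OF root_image[OF mem \<theta>_root[OF that]]])
  qed
  then have "(\<forall>j\<in>{1..n}. a j > 0) \<longleftrightarrow> (\<forall>j\<in>{1..n}. a j \<ge> 0)"
    by (metis less_le)
  moreover have "w n = w 0 \<circ> c"
    using w[of n] partial_product_n[OF \<theta>_root c] by simp
  ultimately show ?thesis
    using special mu_cone_iffs[OF \<theta>_root c w0] by (simp add: a_def)
qed

end
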